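(* Let $\mathcal V$ be the convex set of all nonnegative real arrays $V=(V_{nk}:\ 0\le k\le n-1,\ n=1,2,\dots)$ satisfying $V_{10}=1$ and $$V_{nk}=(k+1)V_{n+1,k}+(n-k)V_{n+1,k+1}\qquad(0\le k\le n-1,\ n=1,2,\dots).$$ Let $$\Theta=\left\{\tfrac{\varkappa}{2(\varkappa+1)}:\ \varkappa=0,1,\dots\right\}\cup\left\{\tfrac12\right\}\cup\left\{\tfrac{\varkappa+2}{2(\varkappa+1)}:\ \varkappa=0,1,\dots\right\},$$ and for $\theta\in\Theta$ let $W(\theta)$ be the unique extreme point $W$ of $\mathcal V$ with $W_{20}=\theta$. Then each $V\in\mathcal V$ can be uniquely represented as a convex combination $$V=\sum_{\theta\in\Theta}p(\theta)\,W(\theta)$$ with $p$ a probability distribution on $\Theta$.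
   Context: The arrays $W(\theta)$ are given explicitly, for $n\ge1$ and $0\le k\le n-1$, by: $W_{nk}(\theta)=\binom{n+\varkappa-k}{n}/(\varkappa+1)^n$ if $\theta=\frac{\varkappa+2}{2(\varkappa+1)}$; $W_{nk}(\theta)=\binom{\varkappa+k+1}{n}/(\varkappa+1)^n$ if $\theta=\frac{\varkappa}{2(\varkappa+1)}$ ($\varkappa=0,1,2,\dots$); and $W_{nk}(\frac12)=\frac1{n!}$. The (countable) convex combination is understood entrywise; a probability distribution on $\Theta$ is a function $p:\Theta\to[0,1]$ with $\sum_{\theta\in\Theta}p(\theta)=1$. *)

theory Defs
  imports "HOL-Analysis.Analysis" "HOL-Library.Function_Algebras"
begin

text \<open>
  The pointwise real vector space structure on functions, so that the notions
  \<^const>\<open>convex\<close> and \<^const>\<open>extreme_point_of\<close> apply to arrays of reals.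
\<close>

instantiation "fun" :: (type, real_vector) real_vector
begin

definition scaleR_fun :: "real \<Rightarrow> ('a \<Rightarrow> 'b) \<Rightarrow> 'a \<Rightarrow> 'b" where
  "scaleR_fun c f = (\<lambda>x. c *\<^sub>R f x)"

instance
  by standard (auto simp: scaleR_fun_def fun_eq_iff algebra_simps)

end

text \<open>
  A triangular array indexed by \<open>n \<ge> 1\<close> and \<open>0 \<le> k \<le> n - 1\<close> is represented by a total
  function that vanishes outside these indices; thus equality of functions is equality
  of arrays, and vector space operations on functions are entrywise operations on arrays.
\<close>

definition eulerian_arrays :: "(nat \<Rightarrow> nat \<Rightarrow> real) set" where
  "eulerian_arrays = {V.
     (\<forall>n k. \<not> (1 \<le> n \<and> k < n) \<longrightarrow> V n k = 0) \<and>
     (\<forall>n\<ge>1. \<forall>k<n. 0 \<le> V n k) \<and>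
     V 1 0 = 1 \<and>
     (\<forall>n\<ge>1. \<forall>k<n. V n k = real (k + 1) * V (n + 1) k + real (n - k) * V (n + 1) (k + 1))}"

lemma eulerian_arraysD:
  assumes "V \<in> eulerian_arrays"
  shows "\<not> (1 \<le> n \<and> k < n) \<Longrightarrow> V n k = 0"
    and "1 \<le> n \<Longrightarrow> k < n \<Longrightarrow> 0 \<le> V n k"
    and "V 1 0 = 1"
    and "1 \<le> n \<Longrightarrow> k < n \<Longrightarrow>
      V n k = real (k + 1) * V (n + 1) k + real (n - k) * V (n + 1) (k + 1)"
proof -
  note * = assms[unfolded eulerian_arrays_def mem_Collect_eq]
  show "\<not> (1 \<le> n \<and> k < n) \<Longrightarrow> V n k = 0" by (rule *[THEN conjunct1, rule_format])
  show "1 \<le> n \<Longrightarrow> k < n \<Longrightarrow> 0 \<le> V n k"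
    by (rule *[THEN conjunct2, THEN conjunct1, rule_format])
  show "V 1 0 = 1" by (rule *[THEN conjunct2, THEN conjunct2, THEN conjunct1])
  show "1 \<le> n \<Longrightarrow> k < n \<Longrightarrow>
      V n k = real (k + 1) * V (n + 1) k + real (n - k) * V (n + 1) (k + 1)"
    by (rule *[THEN conjunct2, THEN conjunct2, THEN conjunct2, rule_format])
qed

lemma convex_eulerian_arrays: "convex eulerian_arrays"
  unfolding convex_def
proof (intro ballI allI impI)
  fix X Y :: "nat \<Rightarrow> nat \<Rightarrow> real" and u v :: real
  assume X: "X \<in> eulerian_arrays" and Y: "Y \<in> eulerian_arrays"
    and uv: "0 \<le> u" "0 \<le> v" "u + v = 1"
  have eq: "(u *\<^sub>R X + v *\<^sub>R Y) n k = u * X n k + v * Y n k" for n k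
    by (simp add: scaleR_fun_def)
  have rec: "u * X n k + v * Y n k =
      real (k + 1) * (u * X (n + 1) k + v * Y (n + 1) k) +
      real (n - k) * (u * X (n + 1) (k + 1) + v * Y (n + 1) (k + 1))"
    if "n \<ge> 1" "k < n" for n k
  proof -
    have "X n k = real (k + 1) * X (n + 1) k + real (n - k) * X (n + 1) (k + 1)"
      and "Y n k = real (k + 1) * Y (n + 1) k + real (n - k) * Y (n + 1) (k + 1)"
      by (rule eulerian_arraysD(4)[OF X that], rule eulerian_arraysD(4)[OF Y that])
    then show ?thesis by (simp only:) (simp only: algebra_simps)
  qed
  show "u *\<^sub>R X + v *\<^sub>R Y \<in> eulerian_arrays"
    unfolding eulerian_arrays_def mem_Collect_eq eq
  proof (intro conjI allI impI)
    show "u * X n k + v * Y n k = 0" if "\<not> (1 \<le> n \<and> k < n)" for n k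
    proof -
      have "X n k = 0" "Y n k = 0" by (rule eulerian_arraysD(1)[OF X that], rule eulerian_arraysD(1)[OF Y that])
      then show ?thesis by simp
    qed
    show "0 \<le> u * X n k + v * Y n k" if "1 \<le> n" "k < n" for n k
    proof -
      have "0 \<le> X n k" "0 \<le> Y n k" by (rule eulerian_arraysD(2)[OF X that], rule eulerian_arraysD(2)[OF Y that])
      then show ?thesis using uv by simp
    qed
    have "X 1 0 = 1" "Y 1 0 = 1" by (rule eulerian_arraysD(3)[OF X], rule eulerian_arraysD(3)[OF Y])
    then show "u * X 1 0 + v * Y 1 0 = 1" using uv by simp
  qed (rule rec)
qed

definition eulerian_params :: "real set" where
  "eulerian_params =
     {real \<kappa> / (2 * (real \<kappa> + 1)) |\<kappa>::nat. True} \<union> {1 / 2} \<union>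
     {(real \<kappa> + 2) / (2 * (real \<kappa> + 1)) |\<kappa>::nat. True}"

definition eulerian_extreme :: "real \<Rightarrow> nat \<Rightarrow> nat \<Rightarrow> real" where
  "eulerian_extreme \<theta> = (THE W. W extreme_point_of eulerian_arrays \<and> W 2 0 = \<theta>)"

end

theory Submission
  imports Defs
begin

text \<open>
  An array \<open>V\<close> of the convex set is a harmonic function on the Eulerian triangle.  The number of
  paths from the apex to \<open>(n, k)\<close> is the Eulerian number \<open>A(n, k)\<close>, so the masses
  \<open>A(n, k) * V n k\<close> (\<open>row_mass\<close>) form a probability distribution on each row.  The proof recovers
  \<open>p\<close> from the way in which this mass escapes as \<open>n\<close> grows.

  The mass in a fixed column \<open>\<kappa>\<close> converges, because \<open>(\<kappa> + 1) ^ n * V n \<kappa>\<close> is nonincreasing for \<open>n > \<kappa>\<close> and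
  \<open>A(n, \<kappa>)\<close> is asymptotic to \<open>(\<kappa> + 1) ^ n\<close>.  Among the arrays \<open>W(\<theta>)\<close> the limit is 1 for
  \<open>\<theta> = (\<kappa> + 2) / (2 * (\<kappa> + 1))\<close> and 0 for all other parameters (\<open>kernel_edge_limit\<close>), so the
  limit must be the weight of this parameter.  The reflection \<open>k \<mapsto> n - 1 - k\<close> treats the
  parameters below \<open>1/2\<close> in the same way.  This gives uniqueness (\<open>representation_edge\<close>,
  \<open>representation_unique\<close>) and prescribes the weights for existence.

  For existence, split off from \<open>V\<close> all parameters other than \<open>1/2\<close> with the prescribed weights.
  The remainder stays nonnegative by a maximum principle: the negative mass of a coherent array is
  nondecreasing in \<open>n\<close>, and here it tends to zero (\<open>coherent_nonneg\<close>, \<open>nonneg_remainder\<close>).  The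
  remainder \<open>R\<close> has no mass near the ends in the limit, and it has to be a multiple of
  \<open>1 / n!\<close> (\<open>edgeless_is_uniform\<close>): the differences of neighbouring entries of \<open>R\<close> form a
  coherent array whose row masses are at most those of \<open>R\<close> divided by the distances to the two
  ends, so they tend to zero, and the maximum principle shows that the differences vanish.

  Extreme points follow formally.  An extreme array equals any array that occurs in its
  representation with positive weight (\<open>extreme_is_kernel\<close>), and each \<open>W(\<theta>)\<close> is extreme because
  its only representation is the unit mass at \<open>\<theta>\<close> (\<open>kernel_extreme\<close>).
\<close>

section \<open>Eulerian numbers\<close>

fun eulerian :: "nat \<Rightarrow> nat \<Rightarrow> nat" where
  "eulerian 0 0 = 1"
| "eulerian 0 (Suc k) = 0"
| "eulerian (Suc n) 0 = eulerian n 0"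
| "eulerian (Suc n) (Suc k) = (k + 2) * eulerian n (Suc k) + (n - k) * eulerian n k"

lemma eulerian_eq_0: "0 < n \<Longrightarrow> n \<le> k \<Longrightarrow> eulerian n k = 0"
proof (induction n arbitrary: k)
  case (Suc n)
  then obtain j where j: "k = Suc j" "n \<le> j" by (cases k) auto
  show ?case
  proof (cases n)
    case 0
    then show ?thesis using j by (cases j) simp_all
  next
    case (Suc m)
    then show ?thesis using j Suc.IH[of k] Suc.IH[of j] by simp
  qed
qed simp

lemma eulerian_pos: "k < n \<Longrightarrow> 0 < eulerian n k"
proof (induction n arbitrary: k)
  case (Suc n)
  show ?case
  proof (cases k)
    case 0
    then show ?thesis using Suc.IH[of 0] by (cases n) (simp_all del: eulerian.simps(4))
  next
    case (Suc j)
    then show ?thesis using Suc.IH[of j] Suc.prems by simp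
  qed
qed simp

lemma eulerian_reflect: "k < n \<Longrightarrow> eulerian n (n - 1 - k) = eulerian n k"
proof (induction n arbitrary: k)
  case (Suc n)
  show ?case
  proof (cases k)
    case 0
    show ?thesis
    proof (cases n)
      case (Suc m)
      have "eulerian (Suc n) (Suc m) = (n - m) * eulerian n m"
        using Suc eulerian_eq_0[of n "Suc m"] by simp
      also have "\<dots> = eulerian n m" using Suc by simp
      also have "\<dots> = eulerian n 0" using Suc Suc.IH[of 0] by simp
      finally show ?thesis using 0 Suc by simp
    qed (use 0 in simp)
  next
    case kS: (Suc j)
    show ?thesis
    proof (cases "k = n")
      case True
      then have "eulerian (Suc n) (Suc n - 1 - k) = eulerian n 0" by simp
      also have "\<dots> = eulerian n j" using Suc.IH[of j] True kS by simp
      also have "\<dots> = eulerian (Suc n) (Suc j)"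
        using eulerian_eq_0[of n "Suc j"] True kS by auto
      finally show ?thesis using kS by simp
    next
      case False
      then have k: "k < n" using Suc.prems by simp
      have *: "n - k = Suc (n - 1 - k)" using k by simp
      have "eulerian (Suc n) (n - k) =
          (n - 1 - k + 2) * eulerian n (n - k) + (n - (n - 1 - k)) * eulerian n (n - 1 - k)"
        unfolding * by simp
      also have "eulerian n (n - k) = eulerian n j"
        using Suc.IH[of j] kS k by simp
      also have "eulerian n (n - 1 - k) = eulerian n k"
        by (rule Suc.IH[OF k])
      finally have "eulerian (Suc n) (n - k) =
          (n - 1 - k + 2) * eulerian n j + (n - (n - 1 - k)) * eulerian n k" .
      moreover have "n - 1 - k + 2 = n - j" "n - (n - 1 - k) = j + 2"
        using kS k by simp_all
      ultimately have "eulerian (Suc n) (n - k) = (n - j) * eulerian n j + (j + 2) * eulerian n k"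
        by (simp only:)
      then show ?thesis using kS by simp
    qed
  qed
qed simp

section \<open>Coherent arrays and the maximum principle\<close>

text \<open>
  The linear recursion alone, with no condition on signs, total mass or the entries outside the
  triangle.  Differences of arrays from the convex set leave that set but stay coherent, and
  most of the argument concerns such differences.
\<close>

definition coherent :: "(nat \<Rightarrow> nat \<Rightarrow> real) \<Rightarrow> bool" where
  "coherent V \<longleftrightarrow> (\<forall>n\<ge>1. \<forall>k<n. V n k = real (k + 1) * V (n + 1) k + real (n - k) * V (n + 1) (k + 1))"

lemma coherentD:
  assumes "coherent V" "k < n"
  shows "V n k = real (k + 1) * V (n + 1) k + real (n - k) * V (n + 1) (k + 1)"
proof -
  have "1 \<le> n" using assms(2) by simp
  then show ?thesis using assms unfolding coherent_def by blast
qed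

text \<open>
  The Eulerian recursion is the adjoint of the recursion for arrays: the weights
  \<open>eulerian n k\<close> count the paths from the apex \<open>(1, 0)\<close> to \<open>(n, k)\<close>.
\<close>

lemma eulerian_sum_transfer:
  fixes f :: "nat \<Rightarrow> real"
  assumes "0 < n"
  shows "(\<Sum>k<n. real (eulerian n k) * (real (k + 1) * f k + real (n - k) * f (k + 1)))
       = (\<Sum>k<n + 1. real (eulerian (n + 1) k) * f k)"
proof -
  have "(\<Sum>k<n + 1. real (eulerian (n + 1) k) * f k)
      = eulerian n 0 * f 0 + (\<Sum>k<n. real (eulerian (n + 1) (Suc k)) * f (Suc k))"
    unfolding Suc_eq_plus1[symmetric] sum.lessThan_Suc_shift by simp
  also have "\<dots> = eulerian n 0 * f 0 + (\<Sum>k<n. real (k + 2) * eulerian n (Suc k) * f (Suc k))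
      + (\<Sum>k<n. real (n - k) * eulerian n k * f (Suc k))"
    by (simp add: sum.distrib[symmetric] distrib_right)
  also have "eulerian n 0 * f 0 + (\<Sum>k<n. real (k + 2) * eulerian n (Suc k) * f (Suc k))
      = (\<Sum>k<Suc n. real (k + 1) * eulerian n k * f k)"
    unfolding sum.lessThan_Suc_shift by (simp add: algebra_simps)
  also have "\<dots> = (\<Sum>k<n. real (k + 1) * eulerian n k * f k)"
    using eulerian_eq_0[of n n] assms by simp
  finally show ?thesis
    by (simp add: sum.distrib[symmetric] algebra_simps)
qed

lemma coherent_total_mass:
  assumes "coherent V" "0 < n"
  shows "(\<Sum>k<n. real (eulerian n k) * V n k) = V 1 0"
  using assms(2)
proof (induction n rule: nat_induct_non_zero)
  case (Suc n)
  then show ?case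
    using eulerian_sum_transfer[of n "V (n + 1)"] coherentD[OF assms(1), of _ n] by simp
qed simp

text \<open>
  Maximum principle.  An entry is a combination with nonnegative coefficients of two entries in
  the next row, so the negative part of an entry is at most the same combination of negative parts.
  Weighted by Eulerian numbers, the total negative part of a row is therefore nondecreasing in the
  row index; if it tends to zero along the rows, it is zero in every row.
\<close>

lemma coherent_nonneg:
  assumes Y: "coherent Y"
    and lim: "(\<lambda>n. \<Sum>k<n. real (eulerian n k) * max 0 (- Y n k)) \<longlonglongrightarrow> 0"
    and kn: "k < n"
  shows "0 \<le> Y n k"
proof -
  define T where "T n = (\<Sum>k<n. real (eulerian n k) * max 0 (- Y n k))" for n
  have step: "T m \<le> T (Suc m)" if "0 < m" for m
  proof -
    have "T m \<le> (\<Sum>k<m. real (eulerian m k) *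
        (real (k + 1) * max 0 (- Y (m + 1) k) + real (m - k) * max 0 (- Y (m + 1) (k + 1))))"
      unfolding T_def
    proof (intro sum_mono mult_left_mono)
      fix k assume "k \<in> {..<m}"
      then have eq: "Y m k = real (k + 1) * Y (m + 1) k + real (m - k) * Y (m + 1) (k + 1)"
        using coherentD[OF Y] by blast
      have "real (k + 1) * (- Y (m + 1) k) \<le> real (k + 1) * max 0 (- Y (m + 1) k)"
        "real (m - k) * (- Y (m + 1) (k + 1)) \<le> real (m - k) * max 0 (- Y (m + 1) (k + 1))"
        by (intro mult_left_mono; simp)+
      moreover have "0 \<le> real (k + 1) * max 0 (- Y (m + 1) k)" "0 \<le> real (m - k) * max 0 (- Y (m + 1) (k + 1))"
        by simp_all
      ultimately show "max 0 (- Y m k)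
          \<le> real (k + 1) * max 0 (- Y (m + 1) k) + real (m - k) * max 0 (- Y (m + 1) (k + 1))"
        unfolding eq by linarith
    qed simp
    also have "\<dots> = T (Suc m)"
      unfolding T_def using eulerian_sum_transfer[OF that, of "\<lambda>k. max 0 (- Y (m + 1) k)"] by simp
    finally show ?thesis .
  qed
  have "T n \<le> T m" if "n \<le> m" for m
    using that
  proof (induction m rule: dec_induct)
    case (step m)
    then show ?case using \<open>\<And>m. 0 < m \<Longrightarrow> T m \<le> T (Suc m)\<close>[of m] kn by linarith
  qed simp
  then have "T n \<le> 0"
    using lim unfolding T_def[symmetric] by (intro LIMSEQ_le_const[of T 0]) auto
  moreover have "real (eulerian n k) * max 0 (- Y n k) \<le> T n"
    unfolding T_def using kn by (intro member_le_sum) auto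
  ultimately have "real (eulerian n k) * max 0 (- Y n k) \<le> 0" by linarith
  then show ?thesis using eulerian_pos[OF kn] by (auto simp: mult_le_0_iff max_def split: if_splits)
qed

definition reflect :: "(nat \<Rightarrow> nat \<Rightarrow> real) \<Rightarrow> nat \<Rightarrow> nat \<Rightarrow> real" where
  "reflect V n k = V n (n - 1 - k)"

lemma coherent_reflect:
  assumes "coherent V"
  shows "coherent (reflect V)"
  unfolding coherent_def reflect_def
proof (intro allI impI)
  fix n k :: nat assume "1 \<le> n" "k < n"
  then show "V n (n - 1 - k) = real (k + 1) * V (n + 1) (n + 1 - 1 - k)
      + real (n - k) * V (n + 1) (n + 1 - 1 - (k + 1))"
    using coherentD[OF assms, of "n - 1 - k" n] by (simp add: algebra_simps Suc_diff_Suc)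
qed

section \<open>The candidate extreme arrays\<close>

text \<open>
  In the variable \<open>t = 2 * \<theta> - 1\<close> the arrays \<open>W(\<theta>)\<close> form a single polynomial family: the entry
  \<open>(n, k)\<close> is the product of the factors \<open>1 + i * t\<close> for \<open>- k \<le> i \<le> n - 1 - k\<close>, divided by \<open>n!\<close>.
  Here \<open>t = 1 / (\<kappa> + 1)\<close>, \<open>t = - 1 / (\<kappa> + 1)\<close> and \<open>t = 0\<close> give the two binomial
  formulas and \<open>1 / n!\<close>.  The product form makes the recursion evident for every real \<open>t\<close>
  and turns the reflection \<open>k \<mapsto> n - 1 - k\<close> into \<open>t \<mapsto> - t\<close>.
\<close>

definition euler_kernel :: "real \<Rightarrow> nat \<Rightarrow> nat \<Rightarrow> real" where
  "euler_kernel \<theta> n k =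
     (if k < n then (\<Prod>j<n. 1 + (real n - 1 - real k - real j) * (2 * \<theta> - 1)) / fact n else 0)"

lemma coherent_kernel: "coherent (euler_kernel \<theta>)"
  unfolding coherent_def
proof (intro allI impI)
  fix n k :: nat assume n: "1 \<le> n" "k < n"
  define t where "t = 2 * \<theta> - 1"
  define Q where "Q = (\<Prod>j<n. 1 + (real n - 1 - real k - real j) * t)"
  have a: "euler_kernel \<theta> n k = Q / fact n"
    using n by (simp add: euler_kernel_def Q_def t_def)
  have "(\<Prod>j<Suc n. 1 + (real (Suc n) - 1 - real k - real j) * t) = (1 + (real n - real k) * t) * Q"
    unfolding prod.lessThan_Suc_shift Q_def by (simp add: algebra_simps)
  then have b: "euler_kernel \<theta> (n + 1) k = (1 + (real n - real k) * t) * Q / fact (n + 1)"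
    using n by (simp add: euler_kernel_def t_def)
  have "(\<Prod>j<Suc n. 1 + (real (Suc n) - 1 - real (k + 1) - real j) * t) = Q * (1 - (real k + 1) * t)"
    unfolding prod.lessThan_Suc Q_def by (simp add: algebra_simps)
  then have c: "euler_kernel \<theta> (n + 1) (k + 1) = Q * (1 - (real k + 1) * t) / fact (n + 1)"
    using n by (simp add: euler_kernel_def t_def)
  have nk: "real (n - k) = real n - real k" using n by simp
  have "real (k + 1) * ((1 + (real n - real k) * t) * Q) + real (n - k) * (Q * (1 - (real k + 1) * t))
      = (real n + 1) * Q"
    unfolding nk by (simp add: algebra_simps)
  then show "euler_kernel \<theta> n k =
      real (k + 1) * euler_kernel \<theta> (n + 1) k + real (n - k) * euler_kernel \<theta> (n + 1) (k + 1)"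
    unfolding a b c by (simp add: add_divide_distrib[symmetric] divide_simps)
qed

lemma kernel_1_0 [simp]: "euler_kernel \<theta> 1 0 = 1" "euler_kernel \<theta> (Suc 0) 0 = 1"
  by (simp_all add: euler_kernel_def)

text \<open>
  The parameter can be read off from the second row, so it identifies an extreme point once all
  extreme points are known to belong to this family.
\<close>

lemma kernel_2_0: "euler_kernel \<theta> 2 0 = \<theta>"
  by (simp add: euler_kernel_def numeral_2_eq_2)

lemma kernel_half: "k < n \<Longrightarrow> euler_kernel (1/2) n k = 1 / fact n"
  by (simp add: euler_kernel_def)

lemma reflect_kernel: "k < n \<Longrightarrow> reflect (euler_kernel \<theta>) n k = euler_kernel (1 - \<theta>) n k"
proof -
  assume k: "k < n"
  have "(\<Prod>j<n. 1 + (real n - 1 - real (n - 1 - k) - real j) * (2 * \<theta> - 1))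
      = (\<Prod>j<n. 1 + (real n - 1 - real (n - 1 - k) - real (n - Suc j)) * (2 * \<theta> - 1))"
    by (rule prod.nat_diff_reindex[symmetric])
  also have "\<dots> = (\<Prod>j<n. 1 + (real n - 1 - real k - real j) * (2 * (1 - \<theta>) - 1))"
    using k by (intro prod.cong) (auto simp: algebra_simps of_nat_diff)
  finally show ?thesis using k by (simp add: euler_kernel_def reflect_def)
qed

text \<open>
  In the variable \<open>t = 2 * \<theta> - 1\<close> the parameters other than \<open>1/2\<close> are the numbers
  \<open>1 / (\<kappa> + 1)\<close> and \<open>- 1 / (\<kappa> + 1)\<close>, which accumulate only at \<open>t = 0\<close>.
\<close>

definition upper_atom :: "nat \<Rightarrow> real" where
  "upper_atom \<kappa> = (real \<kappa> + 2) / (2 * (real \<kappa> + 1))"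

definition lower_atom :: "nat \<Rightarrow> real" where
  "lower_atom \<kappa> = real \<kappa> / (2 * (real \<kappa> + 1))"

lemma upper_atom_t: "2 * upper_atom \<kappa> - 1 = 1 / (real \<kappa> + 1)"
  by (simp add: upper_atom_def field_simps)

lemma lower_atom_eq: "lower_atom \<kappa> = 1 - upper_atom \<kappa>"
  by (simp add: upper_atom_def lower_atom_def field_simps)

lemma upper_atom_alt: "upper_atom \<kappa> = 1/2 + 1 / (2 * (real \<kappa> + 1))"
  by (simp add: upper_atom_def field_simps)

lemma upper_gt_half: "1/2 < upper_atom \<kappa>"
  unfolding upper_atom_alt by (simp add: add_pos_nonneg)

lemma upper_atom_inject [simp]: "upper_atom a = upper_atom b \<longleftrightarrow> a = b"
proof
  assume "upper_atom a = upper_atom b"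
  then have "1 / (real a + 1) = 1 / (real b + 1)"
    unfolding upper_atom_t[symmetric] by simp
  then show "a = b" by (simp add: divide_eq_eq eq_divide_eq)
qed simp

lemma lower_atom_inject [simp]: "lower_atom a = lower_atom b \<longleftrightarrow> a = b"
  unfolding lower_atom_eq by simp

lemma upper_ne_lower [simp]: "upper_atom a \<noteq> lower_atom b" "lower_atom b \<noteq> upper_atom a"
  using upper_gt_half[of a] upper_gt_half[of b] unfolding lower_atom_eq by linarith+

lemma atom_ne_half [simp]: "upper_atom a \<noteq> 1/2" "lower_atom a \<noteq> 1/2"
  using upper_gt_half[of a] unfolding lower_atom_eq by linarith+

lemma eulerian_params_eq: "eulerian_params = insert (1/2) (range upper_atom \<union> range lower_atom)"
  unfolding eulerian_params_def upper_atom_def lower_atom_def by auto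

lemma kernel_upper:
  assumes "k < n"
  shows "euler_kernel (upper_atom \<kappa>) n k = real ((\<kappa> + n - k) choose n) / (real \<kappa> + 1) ^ n"
proof -
  have "(\<Prod>j<n. 1 + (real n - 1 - real k - real j) * (1 / (real \<kappa> + 1)))
      = (\<Prod>j<n. (real (\<kappa> + n - k) - real j) / (real \<kappa> + 1))"
    using assms by (intro prod.cong) (auto simp: field_simps of_nat_diff)
  also have "\<dots> = (\<Prod>j=0..<n. (real (\<kappa> + n - k) - real j)) / (real \<kappa> + 1) ^ n"
    by (simp add: prod_dividef atLeast0LessThan)
  finally show ?thesis
    using assms by (simp add: euler_kernel_def upper_atom_t binomial_gbinomial gbinomial_prod_rev)
qed

lemma kernel_lower:
  assumes "k < n"
  shows "euler_kernel (lower_atom \<kappa>) n k = real ((\<kappa> + k + 1) choose n) / (real \<kappa> + 1) ^ n"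
proof -
  have "euler_kernel (lower_atom \<kappa>) n k = euler_kernel (upper_atom \<kappa>) n (n - 1 - k)"
    using reflect_kernel[OF assms, of "upper_atom \<kappa>"] by (simp add: lower_atom_eq reflect_def)
  moreover have "\<kappa> + n - (n - 1 - k) = \<kappa> + k + 1" using assms by simp
  ultimately show ?thesis using kernel_upper[of "n - 1 - k" n \<kappa>] assms by simp
qed

lemma kernel_nonneg:
  assumes "\<theta> \<in> eulerian_params"
  shows "0 \<le> euler_kernel \<theta> n k"
proof (cases "k < n")
  case True
  consider "\<theta> = 1/2" | \<kappa> where "\<theta> = upper_atom \<kappa>" | \<kappa> where "\<theta> = lower_atom \<kappa>"
    using assms unfolding eulerian_params_eq by auto
  then show ?thesis
    using True by cases (simp_all only: kernel_upper kernel_lower kernel_half, simp_all)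
qed (simp add: euler_kernel_def)

lemma in_eulerian_arrays_iff:
  "V \<in> eulerian_arrays \<longleftrightarrow>
    coherent V \<and> V 1 0 = 1 \<and> (\<forall>n k. k < n \<longrightarrow> 0 \<le> V n k) \<and> (\<forall>n k. n \<le> k \<longrightarrow> V n k = 0)"
proof -
  have *: "1 \<le> n \<and> k < n \<longleftrightarrow> k < n" for n k :: nat by auto
  have **: "(\<forall>n\<ge>1. \<forall>k<n. 0 \<le> V n k) \<longleftrightarrow> (\<forall>n k. k < n \<longrightarrow> 0 \<le> V n k)"
    using * by blast
  show ?thesis
    unfolding eulerian_arrays_def mem_Collect_eq coherent_def[symmetric] * ** not_less by blast
qed

lemma kernel_in_eulerian_arrays: "\<theta> \<in> eulerian_params \<Longrightarrow> euler_kernel \<theta> \<in> eulerian_arrays"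
  unfolding in_eulerian_arrays_iff
proof (intro conjI allI impI)
  show "euler_kernel \<theta> n k = 0" if "n \<le> k" for n k
    using that by (simp add: euler_kernel_def)
qed (rule coherent_kernel kernel_1_0 kernel_nonneg; assumption?)+

section \<open>Mass at the two ends of a row\<close>

text \<open>
  Up to the sign in the argument, the terms are those of the binomial series with exponent
  \<open>- (m + 1)\<close>, which converges inside the unit disc.
\<close>

lemma binomial_times_power_tendsto_0:
  fixes c :: real
  assumes "0 \<le> c" "c < 1"
  shows "(\<lambda>n. real ((m + n) choose n) * c ^ n) \<longlonglongrightarrow> 0"
proof -
  have "summable (\<lambda>n. ((- real (Suc m)) gchoose n) * (- c) ^ n)"
    using gen_binomial_real[of "- c" "- real (Suc m)"] assms by (auto intro: sums_summable)
  moreover have "((- real (Suc m)) gchoose n) * (- c) ^ n = real ((m + n) choose n) * c ^ n" for n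
  proof -
    have "(- real (Suc m)) gchoose n = (-1) ^ n * real ((m + n) choose n)"
      unfolding gbinomial_minus binomial_gbinomial by simp
    then show ?thesis by (simp add: power_minus[of c])
  qed
  ultimately show ?thesis by (simp add: summable_LIMSEQ_zero)
qed

text \<open>
  For an array of the convex set the row masses form a probability distribution on row \<open>n\<close>: the
  law at time \<open>n\<close> of the Markov chain on the Eulerian triangle that the array describes.
\<close>

definition row_mass :: "(nat \<Rightarrow> nat \<Rightarrow> real) \<Rightarrow> nat \<Rightarrow> nat \<Rightarrow> real" where
  "row_mass V n k = real (eulerian n k) * V n k"

lemma row_mass_nonneg: "0 \<le> V n k \<Longrightarrow> 0 \<le> row_mass V n k"
  by (simp add: row_mass_def)

lemma sum_row_mass: "coherent V \<Longrightarrow> 0 < n \<Longrightarrow> (\<Sum>k<n. row_mass V n k) = V 1 0"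
  unfolding row_mass_def by (rule coherent_total_mass)

lemma row_mass_le:
  assumes "coherent V" "\<And>j. j < n \<Longrightarrow> 0 \<le> V n j" "k < n"
  shows "row_mass V n k \<le> V 1 0"
proof -
  have "row_mass V n k \<le> (\<Sum>k<n. row_mass V n k)"
    using assms by (intro member_le_sum) (auto intro: row_mass_nonneg)
  then show ?thesis using sum_row_mass[OF assms(1)] assms(3) by simp
qed

lemma row_mass_reflect: "k < n \<Longrightarrow> row_mass (reflect V) n k = row_mass V n (n - 1 - k)"
  unfolding row_mass_def reflect_def by (simp only: eulerian_reflect)

lemma upper_in_params: "upper_atom \<kappa> \<in> eulerian_params"
  and lower_in_params: "lower_atom \<kappa> \<in> eulerian_params"
  and half_in_params: "1/2 \<in> eulerian_params"
  unfolding eulerian_params_eq by auto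

text \<open>
  One row mass of the array with parameter \<open>upper_atom k\<close> is at most the total mass, and there the
  array has the entry \<open>1 / (k + 1) ^ n\<close>.
\<close>

lemma eulerian_le_power:
  assumes "k < n"
  shows "real (eulerian n k) \<le> (real k + 1) ^ n"
proof -
  have "row_mass (euler_kernel (upper_atom k)) n k \<le> 1"
    using row_mass_le[OF coherent_kernel kernel_nonneg[OF upper_in_params] assms] by simp
  then show ?thesis
    using assms by (simp add: row_mass_def kernel_upper divide_le_eq)
qed

lemma row_mass_upper_below:
  assumes "k < \<kappa>"
  shows "(\<lambda>n. row_mass (euler_kernel (upper_atom \<kappa>)) n k) \<longlonglongrightarrow> 0"
proof (rule tendsto_sandwich[OF _ _ tendsto_const binomial_times_power_tendsto_0])
  let ?c = "(real k + 1) / (real \<kappa> + 1)"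
  show "0 \<le> ?c" "?c < 1" using assms by simp_all
  show "\<forall>\<^sub>F n in sequentially. 0 \<le> row_mass (euler_kernel (upper_atom \<kappa>)) n k"
    by (simp add: row_mass_nonneg kernel_nonneg upper_in_params)
  show "\<forall>\<^sub>F n in sequentially. row_mass (euler_kernel (upper_atom \<kappa>)) n k
      \<le> real ((\<kappa> - k + n) choose n) * ?c ^ n"
    using eventually_gt_at_top[of k]
  proof eventually_elim
    case (elim n)
    have "row_mass (euler_kernel (upper_atom \<kappa>)) n k
        = real (eulerian n k) * (real ((\<kappa> - k + n) choose n) / (real \<kappa> + 1) ^ n)"
      using elim assms by (simp add: row_mass_def kernel_upper)
    also have "\<dots> \<le> (real k + 1) ^ n * (real ((\<kappa> - k + n) choose n) / (real \<kappa> + 1) ^ n)"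
      by (intro mult_right_mono eulerian_le_power elim) simp
    finally show ?case by (simp add: power_divide mult_ac)
  qed
qed

lemma row_mass_upper_above:
  assumes "\<kappa> < k" "k < n"
  shows "row_mass (euler_kernel (upper_atom \<kappa>)) n k = 0"
  using assms by (simp add: row_mass_def kernel_upper binomial_eq_0)

text \<open>
  The array lives on the columns up to \<open>\<kappa>\<close>, and the mass in each earlier column dies out;
  since the total is one, all of the mass ends up in column \<open>\<kappa>\<close>.
\<close>

lemma row_mass_upper_at:
  "(\<lambda>n. row_mass (euler_kernel (upper_atom \<kappa>)) n \<kappa>) \<longlonglongrightarrow> 1"
proof -
  let ?M = "row_mass (euler_kernel (upper_atom \<kappa>))"
  have "(\<lambda>n. 1 - (\<Sum>k<\<kappa>. ?M n k)) \<longlonglongrightarrow> 1 - (\<Sum>k<\<kappa>. 0)"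
    by (intro tendsto_intros row_mass_upper_below) simp
  moreover have "\<forall>\<^sub>F n in sequentially. 1 - (\<Sum>k<\<kappa>. ?M n k) = ?M n \<kappa>"
    using eventually_gt_at_top[of \<kappa>]
  proof eventually_elim
    case (elim n)
    have "1 = (\<Sum>k<n. ?M n k)"
      using sum_row_mass[OF coherent_kernel, of n] elim by simp
    also have "\<dots> = (\<Sum>k<Suc \<kappa>. ?M n k)"
      using elim by (intro sum.mono_neutral_right) (auto intro: row_mass_upper_above)
    finally show ?case by simp
  qed
  ultimately show ?thesis by (simp add: tendsto_cong)
qed

text \<open>
  The array of the preceding limit has the entry \<open>1 / (\<kappa> + 1) ^ n\<close> in column \<open>\<kappa>\<close>.
\<close>

lemma eulerian_asymptotics: "(\<lambda>n. real (eulerian n \<kappa>) / (real \<kappa> + 1) ^ n) \<longlonglongrightarrow> 1"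
proof (rule Lim_transform_eventually[OF row_mass_upper_at])
  show "\<forall>\<^sub>F n in sequentially. row_mass (euler_kernel (upper_atom \<kappa>)) n \<kappa>
      = real (eulerian n \<kappa>) / (real \<kappa> + 1) ^ n"
    using eventually_gt_at_top[of \<kappa>]
    by eventually_elim (simp add: row_mass_def kernel_upper)
qed

lemma row_mass_half: "(\<lambda>n. row_mass (euler_kernel (1/2)) n k) \<longlonglongrightarrow> 0"
proof (rule tendsto_sandwich[OF _ _ tendsto_const])
  show "(\<lambda>n. inverse (fact n) * (real k + 1) ^ n) \<longlonglongrightarrow> 0"
    by (rule summable_LIMSEQ_zero[OF summable_exp])
  show "\<forall>\<^sub>F n in sequentially. 0 \<le> row_mass (euler_kernel (1/2)) n k"
    by (simp only: row_mass_nonneg kernel_nonneg half_in_params eventually_True)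
  show "\<forall>\<^sub>F n in sequentially. row_mass (euler_kernel (1/2)) n k \<le> inverse (fact n) * (real k + 1) ^ n"
    using eventually_gt_at_top[of k]
  proof eventually_elim
    case (elim n)
    show ?case
      unfolding row_mass_def kernel_half[OF elim]
      using eulerian_le_power[OF elim] by (simp add: divide_simps)
  qed
qed

lemma row_mass_lower: "(\<lambda>n. row_mass (euler_kernel (lower_atom \<kappa>)) n k) \<longlonglongrightarrow> 0"
proof (rule tendsto_eventually)
  show "\<forall>\<^sub>F n in sequentially. row_mass (euler_kernel (lower_atom \<kappa>)) n k = 0"
    using eventually_gt_at_top[of "\<kappa> + k + 1"]
    by eventually_elim (simp add: row_mass_def kernel_lower binomial_eq_0)
qed

text \<open>
  The mass that stays in a fixed column separates the parameters: column \<open>k\<close> detects exactly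
  \<open>upper_atom k\<close>.  By reflection, the column at distance \<open>k\<close> from the right end detects exactly
  \<open>lower_atom k\<close>, and no column near either end sees \<open>1/2\<close>.
\<close>

lemma kernel_edge_limit:
  assumes "\<theta> \<in> eulerian_params"
  shows "(\<lambda>n. row_mass (euler_kernel \<theta>) n k) \<longlonglongrightarrow> (if \<theta> = upper_atom k then 1 else 0)"
proof -
  consider "\<theta> = 1/2" | \<kappa> where "\<theta> = upper_atom \<kappa>" | \<kappa> where "\<theta> = lower_atom \<kappa>"
    using assms unfolding eulerian_params_eq by auto
  then show ?thesis
  proof cases
    case 1
    moreover have "upper_atom k \<noteq> 1/2" by (rule atom_ne_half)
    ultimately show ?thesis using row_mass_half[of k] by metis
  next
    case (2 \<kappa>)
    consider "\<kappa> < k" | "\<kappa> = k" | "k < \<kappa>" by linarith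
    then show ?thesis
    proof cases
      case 1
      have "\<forall>\<^sub>F n in sequentially. row_mass (euler_kernel (upper_atom \<kappa>)) n k = 0"
        using eventually_gt_at_top[of k] by eventually_elim (rule row_mass_upper_above[OF 1])
      then show ?thesis using 1 2 by (simp add: tendsto_eventually)
    next
      case 2
      then show ?thesis using \<open>\<theta> = upper_atom \<kappa>\<close> row_mass_upper_at[of \<kappa>] by simp
    next
      case 3
      then show ?thesis using 2 row_mass_upper_below[of k \<kappa>] by simp
    qed
  next
    case 3
    then show ?thesis using row_mass_lower by simp
  qed
qed

lemma params_reflect: "\<theta> \<in> eulerian_params \<Longrightarrow> 1 - \<theta> \<in> eulerian_params"
  unfolding eulerian_params_eq by (auto simp: lower_atom_eq)

lemma kernel_edge_limit_reflect:
  assumes "\<theta> \<in> eulerian_params"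
  shows "(\<lambda>n. row_mass (reflect (euler_kernel \<theta>)) n k) \<longlonglongrightarrow> (if \<theta> = lower_atom k then 1 else 0)"
proof -
  have "1 - \<theta> = upper_atom k \<longleftrightarrow> \<theta> = lower_atom k"
    unfolding lower_atom_eq by auto
  then have "(\<lambda>n. row_mass (euler_kernel (1 - \<theta>)) n k) \<longlonglongrightarrow> (if \<theta> = lower_atom k then 1 else 0)"
    using kernel_edge_limit[OF params_reflect[OF assms], of k] by simp
  then show ?thesis
  proof (rule Lim_transform_eventually)
    show "\<forall>\<^sub>F n in sequentially. row_mass (euler_kernel (1 - \<theta>)) n k = row_mass (reflect (euler_kernel \<theta>)) n k"
      using eventually_gt_at_top[of k] by eventually_elim (simp add: row_mass_def reflect_kernel)
  qed
qed

definition nonneg_array :: "(nat \<Rightarrow> nat \<Rightarrow> real) \<Rightarrow> bool" where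
  "nonneg_array V \<longleftrightarrow> (\<forall>n k. k < n \<longrightarrow> 0 \<le> V n k)"

lemma nonneg_reflect: "nonneg_array V \<Longrightarrow> nonneg_array (reflect V)"
  by (simp add: nonneg_array_def reflect_def)

definition edge_mass :: "(nat \<Rightarrow> nat \<Rightarrow> real) \<Rightarrow> nat \<Rightarrow> real" where
  "edge_mass V k = lim (\<lambda>n. row_mass V n k)"

text \<open>
  The limit exists because \<open>(k + 1) ^ n * V n k\<close> is nonincreasing for \<open>n > k\<close>: drop the second, nonnegative
  term of the recursion.  By the column asymptotics this sequence has the same limit as the row
  masses.
\<close>

lemma edge_mass_limit:
  assumes "coherent V" "nonneg_array V"
  shows "(\<lambda>n. row_mass V n k) \<longlonglongrightarrow> edge_mass V k"
proof -
  define X where "X i = (real k + 1) ^ (i + (k + 1)) * V (i + (k + 1)) k" for i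
  have "X (Suc i) \<le> X i" for i
  proof -
    let ?n = "i + (k + 1)"
    have "V ?n k = real (k + 1) * V (?n + 1) k + real (?n - k) * V (?n + 1) (k + 1)"
      by (rule coherentD[OF assms(1)]) simp
    moreover have "0 \<le> real (?n - k) * V (?n + 1) (k + 1)"
      using assms(2) by (simp add: nonneg_array_def)
    ultimately have "real (k + 1) * V (?n + 1) k \<le> V ?n k" by linarith
    then have "(real k + 1) ^ ?n * (real (k + 1) * V (?n + 1) k) \<le> (real k + 1) ^ ?n * V ?n k"
      by (rule mult_left_mono) simp
    then show ?thesis unfolding X_def by (simp add: algebra_simps)
  qed
  then have "decseq X" by (rule decseq_SucI)
  moreover have "\<forall>i. 0 \<le> X i" using assms(2) by (simp add: X_def nonneg_array_def)
  ultimately obtain L where "X \<longlonglongrightarrow> L" using decseq_convergent[of X 0] by blast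
  then have "(\<lambda>n. (real k + 1) ^ n * V n k) \<longlonglongrightarrow> L"
    unfolding X_def by (rule LIMSEQ_offset)
  then have "(\<lambda>n. real (eulerian n k) / (real k + 1) ^ n * ((real k + 1) ^ n * V n k)) \<longlonglongrightarrow> 1 * L"
    by (intro tendsto_mult eulerian_asymptotics)
  then have "(\<lambda>n. row_mass V n k) \<longlonglongrightarrow> L"
    by (simp add: row_mass_def add_nonneg_eq_0_iff)
  then show ?thesis unfolding edge_mass_def by (simp add: limI)
qed

lemma edge_mass_nonneg:
  assumes "coherent V" "nonneg_array V"
  shows "0 \<le> edge_mass V k"
proof (rule tendsto_lowerbound[OF edge_mass_limit[OF assms]])
  show "\<forall>\<^sub>F n in sequentially. 0 \<le> row_mass V n k"
    using eventually_gt_at_top[of k]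
    by eventually_elim (use assms(2) in \<open>simp add: row_mass_nonneg nonneg_array_def\<close>)
qed simp

section \<open>Remainders after splitting off the ends\<close>

lemma coherent_diff: "coherent X \<Longrightarrow> coherent Y \<Longrightarrow> coherent (\<lambda>n k. X n k - Y n k)"
  unfolding coherent_def
proof (intro allI impI)
  fix n k :: nat
  assume XY: "\<forall>n\<ge>1. \<forall>k<n. X n k = real (k + 1) * X (n + 1) k + real (n - k) * X (n + 1) (k + 1)"
      "\<forall>n\<ge>1. \<forall>k<n. Y n k = real (k + 1) * Y (n + 1) k + real (n - k) * Y (n + 1) (k + 1)"
    and nk: "1 \<le> n" "k < n"
  show "X n k - Y n k = real (k + 1) * (X (n + 1) k - Y (n + 1) k)
      + real (n - k) * (X (n + 1) (k + 1) - Y (n + 1) (k + 1))"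
    using XY[rule_format, OF nk] by (simp only: right_diff_distrib add_diff_add)
qed

lemma coherent_sum:
  assumes "\<And>i. i \<in> F \<Longrightarrow> coherent (X i)"
  shows "coherent (\<lambda>n k. \<Sum>i\<in>F. c i * X i n k)"
  unfolding coherent_def
proof (intro allI impI)
  fix n k :: nat assume "1 \<le> n" "k < n"
  have "(\<Sum>i\<in>F. c i * X i n k)
      = (\<Sum>i\<in>F. c i * (real (k + 1) * X i (n + 1) k + real (n - k) * X i (n + 1) (k + 1)))"
    using coherentD[OF assms \<open>k < n\<close>] by (intro sum.cong) (simp_all only:)
  also have "\<dots> = real (k + 1) * (\<Sum>i\<in>F. c i * X i (n + 1) k)
      + real (n - k) * (\<Sum>i\<in>F. c i * X i (n + 1) (k + 1))"
    by (simp only: sum_distrib_left sum.distrib[symmetric] distrib_left mult.left_commute)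
  finally show "(\<Sum>i\<in>F. c i * X i n k) = real (k + 1) * (\<Sum>i\<in>F. c i * X i (n + 1) k)
      + real (n - k) * (\<Sum>i\<in>F. c i * X i (n + 1) (k + 1))" .
qed

lemma coherent_cmult: "coherent X \<Longrightarrow> coherent (\<lambda>n k. c * X n k)"
  using coherent_sum[of "{()}" "\<lambda>_. X" "\<lambda>_. c"] by simp

text \<open>
  The maximum principle in the form in which it is applied to remainders: only a fixed number of
  columns at each end can carry negative entries, and the mass there tends to zero.
\<close>

lemma nonneg_if_edges_vanish:
  assumes Y: "coherent Y"
    and left: "\<And>k. k < m \<Longrightarrow> (\<lambda>n. row_mass Y n k) \<longlonglongrightarrow> 0"
    and right: "\<And>k. k < m \<Longrightarrow> (\<lambda>n. row_mass (reflect Y) n k) \<longlonglongrightarrow> 0"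
    and interior: "\<And>n k. m \<le> k \<Longrightarrow> k + m < n \<Longrightarrow> 0 \<le> Y n k"
  shows "nonneg_array Y"
  unfolding nonneg_array_def
proof (intro allI impI coherent_nonneg[OF Y])
  let ?b = "\<lambda>n. (\<Sum>k<m. \<bar>row_mass Y n k\<bar>) + (\<Sum>k<m. \<bar>row_mass (reflect Y) n k\<bar>)"
  show "(\<lambda>n. \<Sum>k<n. real (eulerian n k) * max 0 (- Y n k)) \<longlonglongrightarrow> 0"
  proof (rule tendsto_sandwich[OF _ _ tendsto_const])
    have "?b \<longlonglongrightarrow> (\<Sum>k<m. 0) + (\<Sum>k<m. 0)"
      by (intro tendsto_add tendsto_sum tendsto_rabs_zero left right) simp_all
    then show "?b \<longlonglongrightarrow> 0" by simp
    show "\<forall>\<^sub>F n in sequentially. 0 \<le> (\<Sum>k<n. real (eulerian n k) * max 0 (- Y n k))"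
      by (simp add: sum_nonneg)
    show "\<forall>\<^sub>F n in sequentially. (\<Sum>k<n. real (eulerian n k) * max 0 (- Y n k)) \<le> ?b n"
      using eventually_ge_at_top[of m]
    proof eventually_elim
      case (elim n)
      let ?l = "\<lambda>k. if k < m then \<bar>row_mass Y n k\<bar> else 0"
      let ?r = "\<lambda>k. if k < m then \<bar>row_mass (reflect Y) n k\<bar> else 0"
      have "real (eulerian n k) * max 0 (- Y n k) \<le> ?l k + ?r (n - Suc k)" if "k < n" for k
      proof -
        have eq: "row_mass (reflect Y) n (n - Suc k) = row_mass Y n k"
          using row_mass_reflect[of "n - Suc k" n Y] that by simp
        have le: "real (eulerian n k) * max 0 (- Y n k) \<le> \<bar>row_mass Y n k\<bar>"
          by (simp add: row_mass_def abs_mult mult_left_mono)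
        show ?thesis
        proof (cases "k < m \<or> n - Suc k < m")
          case True
          then show ?thesis using le eq by auto
        next
          case False
          then have "0 \<le> Y n k" using that by (intro interior) auto
          then show ?thesis using False by simp
        qed
      qed
      then have "(\<Sum>k<n. real (eulerian n k) * max 0 (- Y n k)) \<le> (\<Sum>k<n. ?l k + ?r (n - Suc k))"
        by (intro sum_mono) simp
      also have "\<dots> = (\<Sum>k<n. ?l k) + (\<Sum>k<n. ?r k)"
        using sum.nat_diff_reindex[of ?r n] by (simp only: sum.distrib)
      also have "(\<Sum>k<n. ?l k) = (\<Sum>k<m. \<bar>row_mass Y n k\<bar>)"
        using elim by (intro sum.mono_neutral_cong_right) auto
      also have "(\<Sum>k<n. ?r k) = (\<Sum>k<m. \<bar>row_mass (reflect Y) n k\<bar>)"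
        using elim by (intro sum.mono_neutral_cong_right) auto
      finally show ?case .
    qed
  qed
qed

section \<open>Arrays without mass at the ends\<close>

text \<open>
  A distribution whose mass leaves every fixed column is concentrated on large \<open>k\<close>, where the
  weight \<open>1 / (k + 1)\<close> is small.
\<close>

lemma tendsto_weighted_sum:
  fixes f :: "nat \<Rightarrow> nat \<Rightarrow> real"
  assumes nonneg: "\<And>n k. k < n \<Longrightarrow> 0 \<le> f n k"
    and total: "\<And>n. (\<Sum>k<n. f n k) \<le> c"
    and lim: "\<And>k. (\<lambda>n. f n k) \<longlonglongrightarrow> 0"
  shows "(\<lambda>n. \<Sum>k<n. f n k / (real k + 1)) \<longlonglongrightarrow> 0"
proof (rule LIMSEQ_I)
  fix e :: real assume e: "0 < e"
  have c: "0 \<le> c" using total[of 0] by simp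
  obtain m :: nat where m: "2 * c / e < real m" using reals_Archimedean2 by blast
  have cm: "c / (real m + 1) < e / 2"
    using m e by (simp add: field_simps)
  have "(\<lambda>n. \<Sum>k<m. f n k) \<longlonglongrightarrow> (\<Sum>k<m. 0)"
    by (intro tendsto_sum lim)
  then have "\<forall>\<^sub>F n in sequentially. (\<Sum>k<m. f n k) < e / 2"
    by (rule order_tendstoD) (use e in simp)
  then have "\<forall>\<^sub>F n in sequentially. norm ((\<Sum>k<n. f n k / (real k + 1)) - 0) < e"
    using eventually_ge_at_top[of m]
  proof eventually_elim
    case (elim n)
    have "(\<Sum>k<n. f n k / (real k + 1)) \<le> (\<Sum>k<n. (if k < m then f n k else 0) + f n k / (real m + 1))"
    proof (rule sum_mono)
      fix k assume "k \<in> {..<n}"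
      then have f: "0 \<le> f n k" using nonneg by simp
      show "f n k / (real k + 1) \<le> (if k < m then f n k else 0) + f n k / (real m + 1)"
      proof (cases "k < m")
        case True
        have "f n k / (real k + 1) \<le> f n k / 1" using f by (intro divide_left_mono) auto
        moreover have "0 \<le> f n k / (real m + 1)" using f by simp
        ultimately show ?thesis using True by simp
      next
        case False
        then show ?thesis using f by (simp add: divide_left_mono)
      qed
    qed
    also have "\<dots> = (\<Sum>k<m. f n k) + (\<Sum>k<n. f n k) / (real m + 1)"
    proof -
      have "(\<Sum>k<n. if k < m then f n k else 0) = (\<Sum>k<m. f n k)"
        using elim by (intro sum.mono_neutral_cong_right) auto
      then show ?thesis by (simp add: sum.distrib sum_divide_distrib)
    qed
    also have "\<dots> \<le> (\<Sum>k<m. f n k) + c / (real m + 1)"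
      using total[of n] by (simp add: divide_right_mono)
    also have "\<dots> < e" using elim cm by linarith
    finally show ?case
      using nonneg by (subst diff_zero, subst real_norm_def, subst abs_of_nonneg) (auto intro!: sum_nonneg)
  qed
  then show "\<exists>no. \<forall>n\<ge>no. norm ((\<Sum>k<n. f n k / (real k + 1)) - 0) < e"
    by (simp add: eventually_sequentially)
qed

lemma row_mass_weighted:
  assumes "coherent V" "nonneg_array V" "\<And>k. (\<lambda>n. row_mass V n k) \<longlonglongrightarrow> 0"
  shows "(\<lambda>n. \<Sum>k<n. row_mass V n k / (real k + 1)) \<longlonglongrightarrow> 0"
proof (rule tendsto_weighted_sum[OF _ _ assms(3)])
  show "0 \<le> row_mass V n k" if "k < n" for n k
    using assms(2) that by (simp add: row_mass_nonneg nonneg_array_def)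
  have "0 \<le> V 1 0" using assms(2) by (simp add: nonneg_array_def)
  then show "(\<Sum>k<n. row_mass V n k) \<le> V 1 0" for n
    using sum_row_mass[OF assms(1), of n] by (cases "n = 0") simp_all
qed

text \<open>
  Taking differences within a row and lowering the row index by one preserves coherence.  On the
  arrays \<open>euler_kernel\<close> this operation is multiplication by \<open>t = 2 * \<theta> - 1\<close>, so that an
  array with vanishing differences should be concentrated at \<open>t = 0\<close>.
\<close>

lemma coherent_difference_array:
  assumes "coherent V"
  shows "coherent (\<lambda>n k. V (n + 1) k - V (n + 1) (k + 1))"
  unfolding coherent_def
proof (intro allI impI)
  fix n k :: nat assume k: "1 \<le> n" "k < n"
  have a: "V (n + 1) k = real (k + 1) * V (n + 1 + 1) k + real (n + 1 - k) * V (n + 1 + 1) (k + 1)"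
    using k by (intro coherentD[OF assms]) simp
  have b: "V (n + 1) (k + 1) = real (k + 1 + 1) * V (n + 1 + 1) (k + 1)
      + real (n + 1 - (k + 1)) * V (n + 1 + 1) (k + 1 + 1)"
    using k by (intro coherentD[OF assms]) simp
  have nk: "real (n + 1 - k) = real n + 1 - real k" "real (n + 1 - (k + 1)) = real n - real k"
    "real (n - k) = real n - real k"
    using k by (simp_all add: of_nat_diff)
  show "V (n + 1) k - V (n + 1) (k + 1)
      = real (k + 1) * (V (n + 1 + 1) k - V (n + 1 + 1) (k + 1))
      + real (n - k) * (V (n + 1 + 1) (k + 1) - V (n + 1 + 1) (k + 1 + 1))"
    unfolding a b nk by (simp add: algebra_simps)
qed

lemma eulerian_step_left: "k < n \<Longrightarrow> (k + 1) * eulerian n k \<le> eulerian (n + 1) k"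
  by (cases k) auto

lemma eulerian_step_right: "k < n \<Longrightarrow> (n - k) * eulerian n k \<le> eulerian (n + 1) (k + 1)"
  by simp

text \<open>
  The factors of the Eulerian recursion give
  \<open>eulerian n k \<le> eulerian (n + 1) k / (k + 1)\<close> and
  \<open>eulerian n k \<le> eulerian (n + 1) (k + 1) / (n - k)\<close>.  Thus the total variation is bounded by
  the row masses weighted by the inverse distances to the two ends, which is small as soon as the
  mass leaves both ends.
\<close>

lemma difference_mass_tendsto_0:
  assumes R: "coherent R" "nonneg_array R"
    and left: "\<And>k. (\<lambda>n. row_mass R n k) \<longlonglongrightarrow> 0"
    and right: "\<And>k. (\<lambda>n. row_mass (reflect R) n k) \<longlonglongrightarrow> 0"
  shows "(\<lambda>n. \<Sum>k<n. real (eulerian n k) * \<bar>R (n + 1) k - R (n + 1) (k + 1)\<bar>) \<longlonglongrightarrow> 0"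
proof (rule tendsto_sandwich[OF _ _ tendsto_const])
  let ?L = "\<lambda>n. \<Sum>k<n. row_mass R n k / (real k + 1)"
  let ?R = "\<lambda>n. \<Sum>k<n. row_mass (reflect R) n k / (real k + 1)"
  have "(\<lambda>n. ?L (n + 1) + ?R (n + 1)) \<longlonglongrightarrow> 0 + 0"
    by (intro tendsto_add LIMSEQ_ignore_initial_segment row_mass_weighted R left right
        coherent_reflect nonneg_reflect)
  then show "(\<lambda>n. ?L (n + 1) + ?R (n + 1)) \<longlonglongrightarrow> 0" by simp
  show "\<forall>\<^sub>F n in sequentially. 0 \<le> (\<Sum>k<n. real (eulerian n k) * \<bar>R (n + 1) k - R (n + 1) (k + 1)\<bar>)"
    by (simp add: sum_nonneg)
  have pos: "0 \<le> R n k" if "k < n" for n k using R(2) that by (simp add: nonneg_array_def)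
  have "(\<Sum>k<n. real (eulerian n k) * \<bar>R (n + 1) k - R (n + 1) (k + 1)\<bar>) \<le> ?L (n + 1) + ?R (n + 1)" for n
  proof -
    have "(\<Sum>k<n. real (eulerian n k) * \<bar>R (n + 1) k - R (n + 1) (k + 1)\<bar>)
        \<le> (\<Sum>k<n. row_mass R (n + 1) k / (real k + 1) + row_mass R (n + 1) (k + 1) / real (n - k))"
    proof (rule sum_mono)
      fix k assume "k \<in> {..<n}"
      then have k: "k < n" by simp
      have "real (eulerian n k) * \<bar>R (n + 1) k - R (n + 1) (k + 1)\<bar>
          \<le> real (eulerian n k) * (R (n + 1) k + R (n + 1) (k + 1))"
        using pos[of k "n + 1"] pos[of "k + 1" "n + 1"] k by (intro mult_left_mono) auto
      also have "\<dots> = real (eulerian n k) * R (n + 1) k + real (eulerian n k) * R (n + 1) (k + 1)"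
        by (rule distrib_left)
      also have "\<dots> \<le> row_mass R (n + 1) k / (real k + 1) + row_mass R (n + 1) (k + 1) / real (n - k)"
      proof (rule add_mono)
        have "real ((k + 1) * eulerian n k) * R (n + 1) k \<le> row_mass R (n + 1) k"
          unfolding row_mass_def
          by (intro mult_right_mono pos of_nat_mono eulerian_step_left k) (use k in simp)
        then show "real (eulerian n k) * R (n + 1) k \<le> row_mass R (n + 1) k / (real k + 1)"
          by (simp add: field_simps)
        have "real ((n - k) * eulerian n k) * R (n + 1) (k + 1) \<le> row_mass R (n + 1) (k + 1)"
          unfolding row_mass_def
          by (intro mult_right_mono pos of_nat_mono eulerian_step_right k) (use k in simp)
        then show "real (eulerian n k) * R (n + 1) (k + 1) \<le> row_mass R (n + 1) (k + 1) / real (n - k)"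
          using k by (simp add: pos_le_divide_eq mult_ac)
      qed
      finally show "real (eulerian n k) * \<bar>R (n + 1) k - R (n + 1) (k + 1)\<bar>
          \<le> row_mass R (n + 1) k / (real k + 1) + row_mass R (n + 1) (k + 1) / real (n - k)" .
    qed
    also have "\<dots> = (\<Sum>k<n. row_mass R (n + 1) k / (real k + 1))
        + (\<Sum>k<n. row_mass R (n + 1) (k + 1) / real (n - k))"
      by (rule sum.distrib)
    also have "(\<Sum>k<n. row_mass R (n + 1) k / (real k + 1)) \<le> ?L (n + 1)"
      using pos by (intro sum_mono2) (auto simp: row_mass_nonneg)
    also have "(\<Sum>k<n. row_mass R (n + 1) (k + 1) / real (n - k))
        = (\<Sum>k<n. row_mass R (n + 1) (n - Suc k + 1) / real (n - (n - Suc k)))"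
      by (rule sum.nat_diff_reindex[symmetric])
    also have "\<dots> = (\<Sum>k<n. row_mass (reflect R) (n + 1) k / (real k + 1))"
    proof (intro sum.cong refl)
      fix k assume "k \<in> {..<n}"
      then have "n - Suc k + 1 = n + 1 - 1 - k" "n - (n - Suc k) = Suc k" "k < n + 1" by auto
      then show "row_mass R (n + 1) (n - Suc k + 1) / real (n - (n - Suc k))
          = row_mass (reflect R) (n + 1) k / (real k + 1)"
        by (simp only: row_mass_reflect of_nat_Suc add.commute)
    qed
    also have "\<dots> \<le> ?R (n + 1)"
      using nonneg_reflect[OF R(2)] by (intro sum_mono2) (auto simp: row_mass_nonneg nonneg_array_def)
    finally show ?thesis by simp
  qed
  then show "\<forall>\<^sub>F n in sequentially. (\<Sum>k<n. real (eulerian n k) * \<bar>R (n + 1) k - R (n + 1) (k + 1)\<bar>)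
      \<le> ?L (n + 1) + ?R (n + 1)" by simp
qed

text \<open>
  By the maximum principle for the difference array and for its negative, all entries in a row
  coincide; the recursion then becomes \<open>R n 0 = (n + 1) * R (n + 1) 0\<close>.
\<close>

lemma edgeless_is_uniform:
  assumes R: "coherent R" "nonneg_array R"
    and left: "\<And>k. (\<lambda>n. row_mass R n k) \<longlonglongrightarrow> 0"
    and right: "\<And>k. (\<lambda>n. row_mass (reflect R) n k) \<longlonglongrightarrow> 0"
    and kn: "k < n"
  shows "R n k = R 1 0 / fact n"
proof -
  define D where "D n k = R (n + 1) k - R (n + 1) (k + 1)" for n k
  note lim = difference_mass_tendsto_0[OF R left right, folded D_def]
  have D: "coherent D" unfolding D_def by (rule coherent_difference_array[OF R(1)])
  have D0: "D n k = 0" if "k < n" for n k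
  proof (rule antisym)
    have le: "real (eulerian n k) * max 0 x \<le> real (eulerian n k) * \<bar>x\<bar>" for n k x
      by (intro mult_left_mono) auto
    have "(\<lambda>n. \<Sum>k<n. real (eulerian n k) * max 0 (- D n k)) \<longlonglongrightarrow> 0"
      by (rule tendsto_sandwich[OF _ _ tendsto_const lim])
        (use le[of _ _ "- D _ _"] in \<open>auto intro!: sum_nonneg sum_mono always_eventually\<close>)
    then show "0 \<le> D n k" by (rule coherent_nonneg[OF D _ that])
    have D': "coherent (\<lambda>n k. - D n k)"
      using coherent_cmult[OF D, of "- 1"] by simp
    have "(\<lambda>n. \<Sum>k<n. real (eulerian n k) * max 0 (- (- D n k))) \<longlonglongrightarrow> 0"
      by (rule tendsto_sandwich[OF _ _ tendsto_const lim])
        (use le[of _ _ "D _ _"] in \<open>auto intro!: sum_nonneg sum_mono always_eventually\<close>)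
    then have "0 \<le> - D n k" by (rule coherent_nonneg[OF D' _ that])
    then show "D n k \<le> 0" by simp
  qed
  have row: "R n j = R n 0" if "j < n" for n j
    using that
  proof (induction j)
    case (Suc j)
    then have "D (n - 1) j = 0" by (intro D0) simp
    then show ?case using Suc by (simp add: D_def)
  qed simp
  have col: "R n 0 = R 1 0 / fact n" if "0 < n" for n
    using that
  proof (induction n rule: nat_induct_non_zero)
    case (Suc n)
    have "R n 0 = R (n + 1) 0 + real n * R (n + 1) 1"
      using coherentD[OF R(1), of 0 n] Suc by simp
    also have "R (n + 1) 1 = R (n + 1) 0" using Suc by (intro row) simp
    finally have "R n 0 = (real n + 1) * R (n + 1) 0" by (simp add: algebra_simps)
    then have "fact (Suc n) * R (Suc n) 0 = fact n * R n 0" by (simp add: algebra_simps)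
    also have "\<dots> = R 1 0" using Suc by simp
    finally show ?case by (metis fact_nonzero nonzero_mult_div_cancel_left)
  qed simp
  show ?thesis unfolding row[OF kn] by (rule col) (use kn in simp)
qed

section \<open>The atomic part of an array\<close>

text \<open>
  The weight that an array must give to a parameter other than \<open>1/2\<close>: the mass that persists in
  the column detecting this parameter, counted from the left for \<open>\<theta> > 1/2\<close> and from the right
  for \<open>\<theta> < 1/2\<close>.
\<close>

definition atom_weight :: "(nat \<Rightarrow> nat \<Rightarrow> real) \<Rightarrow> real \<Rightarrow> real" where
  "atom_weight V \<theta> =
     (if \<theta> \<in> range upper_atom then edge_mass V (inv upper_atom \<theta>)
      else edge_mass (reflect V) (inv lower_atom \<theta>))"

lemma inj_atoms: "inj upper_atom" "inj lower_atom"
  by (simp_all add: inj_def)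

lemma atom_weight_upper: "atom_weight V (upper_atom \<kappa>) = edge_mass V \<kappa>"
  by (simp add: atom_weight_def inj_atoms)

lemma atom_weight_lower: "atom_weight V (lower_atom \<kappa>) = edge_mass (reflect V) \<kappa>"
  by (auto simp add: atom_weight_def inj_atoms)

definition atoms :: "real set" where "atoms = range upper_atom \<union> range lower_atom"

definition atoms_below :: "nat \<Rightarrow> real set" where
  "atoms_below m = upper_atom ` {..<m} \<union> lower_atom ` {..<m}"

lemma atoms_below_subset: "atoms_below m \<subseteq> eulerian_params"
  unfolding atoms_below_def eulerian_params_eq by auto

lemma finite_atoms_below [simp]: "finite (atoms_below m)"
  by (simp add: atoms_below_def)

lemma params_insert: "eulerian_params = insert (1/2) atoms" and half_notin: "1/2 \<notin> atoms"
  unfolding eulerian_params_eq atoms_def using atom_ne_half by (simp, metis UnE imageE)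

lemma finite_atoms_covered:
  assumes "finite F" "F \<subseteq> atoms"
  obtains m where "F \<subseteq> atoms_below m"
proof -
  have "\<exists>m. F \<subseteq> atoms_below m"
    using assms
  proof (induction F)
    case (insert \<theta> F)
    then obtain m where m: "F \<subseteq> atoms_below m" by auto
    obtain \<kappa> where "\<theta> = upper_atom \<kappa> \<or> \<theta> = lower_atom \<kappa>"
      using insert.prems by (auto simp: atoms_def)
    then have "\<theta> \<in> atoms_below (max m (Suc \<kappa>))"
      by (auto simp: atoms_below_def)
    moreover have "atoms_below m \<subseteq> atoms_below (max m (Suc \<kappa>))"
      unfolding atoms_below_def by (intro Un_mono image_mono) auto
    ultimately have "insert \<theta> F \<subseteq> atoms_below (max m (Suc \<kappa>))"
      using m by blast
    then show ?case by blast
  qed simp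
  then show ?thesis using that by blast
qed

lemma atom_weight_nonneg:
  assumes "coherent V" "nonneg_array V"
  shows "0 \<le> atom_weight V \<theta>"
  using edge_mass_nonneg[OF assms] edge_mass_nonneg[OF coherent_reflect[OF assms(1)] nonneg_reflect[OF assms(2)]]
  by (simp add: atom_weight_def)

lemma row_mass_diff: "row_mass (\<lambda>n k. X n k - Y n k) n k = row_mass X n k - row_mass Y n k"
  by (simp add: row_mass_def algebra_simps)

lemma row_mass_sum:
  "row_mass (\<lambda>n k. \<Sum>i\<in>F. c i * X i n k) n k = (\<Sum>i\<in>F. c i * row_mass (X i) n k)"
  by (simp add: row_mass_def sum_distrib_left mult_ac)

lemma reflect_diff: "reflect (\<lambda>n k. X n k - Y n k) = (\<lambda>n k. reflect X n k - reflect Y n k)"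
  by (simp add: reflect_def fun_eq_iff)

lemma reflect_sum: "reflect (\<lambda>n k. \<Sum>i\<in>F. c i * X i n k) = (\<lambda>n k. \<Sum>i\<in>F. c i * reflect (X i) n k)"
  by (simp add: reflect_def fun_eq_iff)

lemma partial_sum_edge:
  assumes "finite F" "F \<subseteq> eulerian_params"
  shows "(\<lambda>n. row_mass (\<lambda>n k. \<Sum>\<theta>\<in>F. c \<theta> * euler_kernel \<theta> n k) n k)
      \<longlonglongrightarrow> (if upper_atom k \<in> F then c (upper_atom k) else 0)"
    and "(\<lambda>n. row_mass (reflect (\<lambda>n k. \<Sum>\<theta>\<in>F. c \<theta> * euler_kernel \<theta> n k)) n k)
      \<longlonglongrightarrow> (if lower_atom k \<in> F then c (lower_atom k) else 0)"
proof -
  have "(\<lambda>n. \<Sum>\<theta>\<in>F. c \<theta> * row_mass (euler_kernel \<theta>) n k)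
      \<longlonglongrightarrow> (\<Sum>\<theta>\<in>F. c \<theta> * (if \<theta> = upper_atom k then 1 else 0))"
    using assms by (intro tendsto_sum tendsto_mult_left kernel_edge_limit) auto
  also have "(\<Sum>\<theta>\<in>F. c \<theta> * (if \<theta> = upper_atom k then 1 else 0))
      = (\<Sum>\<theta>\<in>F. if \<theta> = upper_atom k then c \<theta> else 0)"
    by (intro sum.cong) auto
  finally show "(\<lambda>n. row_mass (\<lambda>n k. \<Sum>\<theta>\<in>F. c \<theta> * euler_kernel \<theta> n k) n k)
      \<longlonglongrightarrow> (if upper_atom k \<in> F then c (upper_atom k) else 0)"
    using assms(1) by (simp add: row_mass_sum)
  have "(\<lambda>n. \<Sum>\<theta>\<in>F. c \<theta> * row_mass (reflect (euler_kernel \<theta>)) n k)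
      \<longlonglongrightarrow> (\<Sum>\<theta>\<in>F. c \<theta> * (if \<theta> = lower_atom k then 1 else 0))"
    using assms by (intro tendsto_sum tendsto_mult_left kernel_edge_limit_reflect) auto
  also have "(\<Sum>\<theta>\<in>F. c \<theta> * (if \<theta> = lower_atom k then 1 else 0))
      = (\<Sum>\<theta>\<in>F. if \<theta> = lower_atom k then c \<theta> else 0)"
    by (intro sum.cong) auto
  finally show "(\<lambda>n. row_mass (reflect (\<lambda>n k. \<Sum>\<theta>\<in>F. c \<theta> * euler_kernel \<theta> n k)) n k)
      \<longlonglongrightarrow> (if lower_atom k \<in> F then c (lower_atom k) else 0)"
    using assms(1) by (simp add: row_mass_sum reflect_sum)
qed

definition atomic_part :: "(nat \<Rightarrow> nat \<Rightarrow> real) \<Rightarrow> nat \<Rightarrow> nat \<Rightarrow> nat \<Rightarrow> real" where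
  "atomic_part V m n k = (\<Sum>\<theta>\<in>atoms_below m. atom_weight V \<theta> * euler_kernel \<theta> n k)"

lemma coherent_remainder:
  "coherent V \<Longrightarrow> coherent (\<lambda>n k. V n k - atomic_part V m n k)"
  unfolding atomic_part_def by (intro coherent_diff coherent_sum coherent_kernel)

lemma remainder_edges:
  assumes V: "coherent V" "nonneg_array V" and k: "k < m"
  shows "(\<lambda>n. row_mass (\<lambda>n k. V n k - atomic_part V m n k) n k) \<longlonglongrightarrow> 0"
    and "(\<lambda>n. row_mass (reflect (\<lambda>n k. V n k - atomic_part V m n k)) n k) \<longlonglongrightarrow> 0"
proof -
  have in_atoms: "upper_atom k \<in> atoms_below m" "lower_atom k \<in> atoms_below m"
    using k by (auto simp: atoms_below_def)
  note lim = partial_sum_edge[OF finite_atoms_below[of m] atoms_below_subset, of "atom_weight V" k]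
  show "(\<lambda>n. row_mass (\<lambda>n k. V n k - atomic_part V m n k) n k) \<longlonglongrightarrow> 0"
    using tendsto_diff[OF edge_mass_limit[OF V, of k] lim(1)] in_atoms
    unfolding row_mass_diff atomic_part_def by (simp add: atom_weight_upper)
  show "(\<lambda>n. row_mass (reflect (\<lambda>n k. V n k - atomic_part V m n k)) n k) \<longlonglongrightarrow> 0"
    using tendsto_diff[OF edge_mass_limit[OF coherent_reflect[OF V(1)] nonneg_reflect[OF V(2)], of k] lim(2)] in_atoms
    unfolding row_mass_diff reflect_diff atomic_part_def by (simp add: atom_weight_lower)
qed

text \<open>
  The finitely many atoms below \<open>m\<close> vanish in the interior of each row, and at the ends the
  weights are chosen so that the mass of the difference tends to zero.
\<close>

lemma nonneg_remainder:
  assumes V: "coherent V" "nonneg_array V"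
  shows "nonneg_array (\<lambda>n k. V n k - atomic_part V m n k)"
proof (rule nonneg_if_edges_vanish[OF coherent_remainder[OF V(1)] remainder_edges[OF V]])
  fix n k assume nk: "m \<le> k" "k + m < n"
  have "euler_kernel \<theta> n k = 0" if "\<theta> \<in> atoms_below m" for \<theta>
    using that nk by (auto simp: atoms_below_def kernel_upper kernel_lower binomial_eq_0)
  then show "0 \<le> V n k - atomic_part V m n k"
    using V(2) nk by (simp add: atomic_part_def nonneg_array_def)
qed simp_all

section \<open>Existence and uniqueness of representations\<close>

definition represents :: "(real \<Rightarrow> real) \<Rightarrow> (nat \<Rightarrow> nat \<Rightarrow> real) \<Rightarrow> bool" where
  "represents p V \<longleftrightarrow> (\<forall>\<theta>\<in>eulerian_params. 0 \<le> p \<theta>) \<and> (p has_sum 1) eulerian_params \<and>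
     (\<forall>n k. k < n \<longrightarrow> ((\<lambda>\<theta>. p \<theta> * euler_kernel \<theta> n k) has_sum V n k) eulerian_params)"

lemma finite_atoms_sum_le:
  assumes V: "coherent V" "nonneg_array V" and F: "finite F" "F \<subseteq> atoms" and "k < n"
  shows "(\<Sum>\<theta>\<in>F. atom_weight V \<theta> * euler_kernel \<theta> n k) \<le> V n k"
proof -
  obtain m where m: "F \<subseteq> atoms_below m" using finite_atoms_covered[OF F] .
  have "(\<Sum>\<theta>\<in>F. atom_weight V \<theta> * euler_kernel \<theta> n k) \<le> atomic_part V m n k"
    unfolding atomic_part_def using m atoms_below_subset atom_weight_nonneg[OF V]
    by (intro sum_mono2) (auto intro!: mult_nonneg_nonneg kernel_nonneg)
  also have "\<dots> \<le> V n k"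
    using nonneg_remainder[OF V, of m] \<open>k < n\<close> by (simp add: nonneg_array_def)
  finally show ?thesis .
qed

text \<open>
  Subtracting all atoms leaves a nonnegative array \<open>R\<close>.  It lies below every partial remainder, so
  its mass leaves both ends and it is a multiple of the array \<open>1 / n!\<close>; this multiple is the
  weight of \<open>1/2\<close>.
\<close>

lemma representation_exists:
  assumes "V \<in> eulerian_arrays"
  shows "\<exists>p. represents p V"
proof -
  have V: "coherent V" "nonneg_array V" and V10: "V 1 0 = 1"
    using assms by (auto simp: in_eulerian_arrays_iff nonneg_array_def)
  have term_nonneg: "0 \<le> atom_weight V \<theta> * euler_kernel \<theta> n k" if "\<theta> \<in> atoms" for \<theta> n k
    using that atom_weight_nonneg[OF V] by (simp add: kernel_nonneg params_insert)
  define S where "S n k = infsum (\<lambda>\<theta>. atom_weight V \<theta> * euler_kernel \<theta> n k) atoms" for n k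
  have S: "((\<lambda>\<theta>. atom_weight V \<theta> * euler_kernel \<theta> n k) has_sum S n k) atoms" if "k < n" for n k
    unfolding S_def
  proof (intro has_sum_infsum nonneg_bdd_above_summable_on term_nonneg)
    show "bdd_above (sum (\<lambda>\<theta>. atom_weight V \<theta> * euler_kernel \<theta> n k) ` {F. F \<subseteq> atoms \<and> finite F})"
      using finite_atoms_sum_le[OF V _ _ that] by (intro bdd_aboveI2[where M = "V n k"]) auto
  qed
  define R where "R n k = V n k - S n k" for n k
  have "coherent S"
    unfolding coherent_def
  proof (intro allI impI)
    fix n k :: nat assume k: "1 \<le> n" "k < n"
    have "((\<lambda>\<theta>. real (k + 1) * (atom_weight V \<theta> * euler_kernel \<theta> (n + 1) k)
          + real (n - k) * (atom_weight V \<theta> * euler_kernel \<theta> (n + 1) (k + 1)))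
        has_sum (real (k + 1) * S (n + 1) k + real (n - k) * S (n + 1) (k + 1))) atoms"
      using k by (intro has_sum_add has_sum_cmult_right S) auto
    moreover have "real (k + 1) * (atom_weight V \<theta> * euler_kernel \<theta> (n + 1) k)
          + real (n - k) * (atom_weight V \<theta> * euler_kernel \<theta> (n + 1) (k + 1))
        = atom_weight V \<theta> * euler_kernel \<theta> n k" for \<theta>
      unfolding coherentD[OF coherent_kernel k(2)] by (simp only: distrib_left mult.left_commute)
    ultimately show "S n k = real (k + 1) * S (n + 1) k + real (n - k) * S (n + 1) (k + 1)"
      using has_sum_unique[OF S[OF k(2)]] by simp
  qed
  then have R: "coherent R"
    unfolding R_def by (intro coherent_diff V)
  have R_nonneg: "nonneg_array R"
    unfolding nonneg_array_def R_def using has_sum_le_finite_sums[OF S] finite_atoms_sum_le[OF V]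
    by (metis diff_ge_0_iff_ge)
  have R_le: "R n k \<le> V n k - atomic_part V m n k" if "k < n" for m n k
  proof -
    have "atoms_below m \<subseteq> atoms" by (auto simp: atoms_below_def atoms_def)
    then have "atomic_part V m n k \<le> S n k"
      unfolding atomic_part_def using term_nonneg
      by (intro finite_sum_le_has_sum[OF S[OF that]]) auto
    then show ?thesis by (simp add: R_def)
  qed
  have left: "(\<lambda>n. row_mass R n k) \<longlonglongrightarrow> 0" for k
  proof (rule tendsto_sandwich[OF _ _ tendsto_const remainder_edges(1)[OF V lessI]])
    show "\<forall>\<^sub>F n in sequentially. 0 \<le> row_mass R n k"
      using eventually_gt_at_top[of k]
      by eventually_elim (use R_nonneg in \<open>simp add: row_mass_nonneg nonneg_array_def\<close>)
    show "\<forall>\<^sub>F n in sequentially. row_mass R n k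
        \<le> row_mass (\<lambda>n k'. V n k' - atomic_part V (Suc k) n k') n k"
      using eventually_gt_at_top[of k]
      by eventually_elim (simp add: row_mass_def mult_left_mono R_le)
  qed
  have right: "(\<lambda>n. row_mass (reflect R) n k) \<longlonglongrightarrow> 0" for k
  proof (rule tendsto_sandwich[OF _ _ tendsto_const remainder_edges(2)[OF V lessI]])
    show "\<forall>\<^sub>F n in sequentially. 0 \<le> row_mass (reflect R) n k"
      using eventually_gt_at_top[of k]
      by eventually_elim (use nonneg_reflect[OF R_nonneg] in \<open>simp add: row_mass_nonneg nonneg_array_def\<close>)
    show "\<forall>\<^sub>F n in sequentially. row_mass (reflect R) n k
        \<le> row_mass (reflect (\<lambda>n k'. V n k' - atomic_part V (Suc k) n k')) n k"
      using eventually_gt_at_top[of k]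
      by eventually_elim (simp add: row_mass_def reflect_def mult_left_mono R_le)
  qed
  define p where "p = (\<lambda>\<theta>. if \<theta> = 1/2 then R 1 0 else atom_weight V \<theta>)"
  have p_atoms: "p \<theta> = atom_weight V \<theta>" if "\<theta> \<in> atoms" for \<theta>
    using that half_notin unfolding p_def by metis
  have p_nonneg: "0 \<le> p \<theta>" for \<theta>
    using atom_weight_nonneg[OF V] R_nonneg by (simp add: p_def nonneg_array_def)
  have rep: "((\<lambda>\<theta>. p \<theta> * euler_kernel \<theta> n k) has_sum V n k) eulerian_params" if "k < n" for n k
  proof -
    have "((\<lambda>\<theta>. p \<theta> * euler_kernel \<theta> n k) has_sum S n k) atoms"
      using S[OF that] by (rule has_sum_cong[THEN iffD1, rotated]) (simp add: p_atoms)
    then have "((\<lambda>\<theta>. p \<theta> * euler_kernel \<theta> n k) has_sum (p (1/2) * euler_kernel (1/2) n k + S n k))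
        eulerian_params"
      unfolding params_insert by (rule has_sum_insert[OF half_notin])
    moreover have "p (1/2) * euler_kernel (1/2) n k = R n k"
      unfolding kernel_half[OF that] edgeless_is_uniform[OF R R_nonneg left right that]
      by (simp add: p_def)
    ultimately show ?thesis by (simp add: R_def)
  qed
  have "represents p V"
    unfolding represents_def using p_nonneg rep rep[of 0 1] V10 by simp
  then show ?thesis by blast
qed

text \<open>
  For finite mixtures this is the edge limit of the kernels.  In general a finite partial mixture
  leaves a nonnegative coherent array of total mass less than \<open>e\<close>, and each of its row masses is
  bounded by that total, uniformly in the row.
\<close>

lemma representation_edge:
  assumes V: "coherent V" "nonneg_array V" and p: "represents p V"
  shows "edge_mass V \<kappa> = p (upper_atom \<kappa>)"
    and "edge_mass (reflect V) \<kappa> = p (lower_atom \<kappa>)"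
proof -
  have p_nonneg: "0 \<le> p \<theta>" if "\<theta> \<in> eulerian_params" for \<theta>
    using p that by (simp add: represents_def)
  have p_sum: "(p has_sum 1) eulerian_params"
    and rep: "\<And>n k. k < n \<Longrightarrow> ((\<lambda>\<theta>. p \<theta> * euler_kernel \<theta> n k) has_sum V n k) eulerian_params"
    using p by (auto simp: represents_def)
  have V10: "V 1 0 = 1"
    using has_sum_unique[OF rep[of 0 1] ] p_sum by simp
  have "\<bar>edge_mass V \<kappa> - p (upper_atom \<kappa>)\<bar> \<le> e \<and> \<bar>edge_mass (reflect V) \<kappa> - p (lower_atom \<kappa>)\<bar> \<le> e"
    if e: "0 < e" for e
  proof -
    have "\<forall>\<^sub>F F in finite_subsets_at_top eulerian_params. dist (sum p F) 1 < e"
      using p_sum e unfolding has_sum_def by (rule tendstoD)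
    then obtain F0 where F0: "finite F0" "F0 \<subseteq> eulerian_params"
        "\<And>F. finite F \<Longrightarrow> F0 \<subseteq> F \<Longrightarrow> F \<subseteq> eulerian_params \<Longrightarrow> dist (sum p F) 1 < e"
      unfolding eventually_finite_subsets_at_top by metis
    define F where "F = F0 \<union> {upper_atom \<kappa>, lower_atom \<kappa>}"
    have F: "finite F" "F \<subseteq> eulerian_params" "upper_atom \<kappa> \<in> F" "lower_atom \<kappa> \<in> F"
      using F0 upper_in_params lower_in_params by (auto simp: F_def)
    have close: "1 - sum p F < e"
      using F0(3)[of F] F by (auto simp: F_def dist_real_def abs_less_iff)
    define P where "P n k = (\<Sum>\<theta>\<in>F. p \<theta> * euler_kernel \<theta> n k)" for n k
    define Z where "Z n k = V n k - P n k" for n k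
    have Z: "coherent Z"
      unfolding Z_def P_def by (intro coherent_diff coherent_sum V coherent_kernel)
    have Z_nonneg: "nonneg_array Z"
      unfolding nonneg_array_def Z_def P_def
    proof (intro allI impI)
      fix n k :: nat assume "k < n"
      then have "(\<Sum>\<theta>\<in>F. p \<theta> * euler_kernel \<theta> n k) \<le> V n k"
        using F by (intro finite_sum_le_has_sum[OF rep]) (auto intro!: mult_nonneg_nonneg p_nonneg kernel_nonneg)
      then show "0 \<le> V n k - (\<Sum>\<theta>\<in>F. p \<theta> * euler_kernel \<theta> n k)" by simp
    qed
    have Z10: "Z 1 0 < e" using close V10 by (simp add: Z_def P_def)
    have bound: "\<bar>x\<bar> \<le> e"
      if "coherent X" "nonneg_array X" "X 1 0 < e" "(\<lambda>n. row_mass X n \<kappa>) \<longlonglongrightarrow> x" for X x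
    proof -
      have "\<forall>\<^sub>F n in sequentially. \<bar>row_mass X n \<kappa>\<bar> \<le> e"
        using eventually_gt_at_top[of \<kappa>]
      proof eventually_elim
        case (elim n)
        have "0 \<le> row_mass X n \<kappa>" "row_mass X n \<kappa> \<le> X 1 0"
          using that(2) elim by (auto intro: row_mass_nonneg row_mass_le[OF that(1)] simp: nonneg_array_def simp del: One_nat_def)
        then show ?case using that(3) by simp
      qed
      then show ?thesis
        by (rule tendsto_upperbound[OF tendsto_rabs[OF that(4)]]) simp
    qed
    \<comment> \<open>\<open>F\<close> contains both atoms of index \<open>\<kappa>\<close>, so \<open>P\<close> contributes their full weights.\<close>
    have "(\<lambda>n. row_mass Z n \<kappa>) \<longlonglongrightarrow> edge_mass V \<kappa> - p (upper_atom \<kappa>)"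
      using tendsto_diff[OF edge_mass_limit[OF V, of \<kappa>] partial_sum_edge(1)[OF F(1,2), of p \<kappa>]] F(3)
      unfolding Z_def P_def row_mass_diff by simp
    moreover have "(\<lambda>n. row_mass (reflect Z) n \<kappa>) \<longlonglongrightarrow> edge_mass (reflect V) \<kappa> - p (lower_atom \<kappa>)"
      using tendsto_diff[OF edge_mass_limit[OF coherent_reflect nonneg_reflect, OF V, of \<kappa>]
          partial_sum_edge(2)[OF F(1,2), of p \<kappa>]] F(4)
      unfolding Z_def P_def reflect_diff row_mass_diff by simp
    moreover have "reflect Z 1 0 < e" using Z10 by (simp add: reflect_def)
    ultimately show ?thesis
      using bound Z Z_nonneg Z10 coherent_reflect nonneg_reflect by blast
  qed
  then have "\<bar>edge_mass V \<kappa> - p (upper_atom \<kappa>)\<bar> \<le> 0" "\<bar>edge_mass (reflect V) \<kappa> - p (lower_atom \<kappa>)\<bar> \<le> 0"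
    by (meson dense_ge)+
  then show "edge_mass V \<kappa> = p (upper_atom \<kappa>)" "edge_mass (reflect V) \<kappa> = p (lower_atom \<kappa>)" by simp_all
qed

text \<open>
  The edge masses determine every weight except that of \<open>1/2\<close>, and this one is what remains of the
  total mass.
\<close>

lemma representation_unique:
  assumes "V \<in> eulerian_arrays" "represents p V" "represents q V" "\<theta> \<in> eulerian_params"
  shows "p \<theta> = q \<theta>"
proof -
  have V: "coherent V" "nonneg_array V"
    using assms(1) by (auto simp: in_eulerian_arrays_iff nonneg_array_def)
  have atoms: "p \<theta> = q \<theta>" if "\<theta> \<in> atoms" for \<theta>
    using that representation_edge[OF V assms(2)] representation_edge[OF V assms(3)]
    by (auto simp: atoms_def)
  have half: "r (1/2) = 1 - infsum r atoms" if "represents r V" for r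
  proof -
    have r: "(r has_sum 1) (insert (1/2) atoms)"
      using that unfolding represents_def params_insert by blast
    have "r summable_on atoms"
      by (rule summable_on_subset_banach[OF has_sum_imp_summable[OF r]]) auto
    then have "(r has_sum (r (1/2) + infsum r atoms)) (insert (1/2) atoms)"
      by (intro has_sum_insert half_notin has_sum_infsum)
    then have "1 = r (1/2) + infsum r atoms" by (rule has_sum_unique[OF r])
    then show ?thesis by simp
  qed
  have "p (1/2) = q (1/2)"
    unfolding half[OF assms(2)] half[OF assms(3)] using infsum_cong[OF atoms] by simp
  then show ?thesis using assms(4) atoms unfolding params_insert by (metis insertE)
qed

section \<open>Extreme points\<close>

lemma represents_point:
  assumes "\<theta> \<in> eulerian_params"
  shows "represents (\<lambda>x. if x = \<theta> then 1 else 0) (euler_kernel \<theta>)"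
  unfolding represents_def using assms
  by (auto intro!: has_sum_finite_neutralI[where B = "{\<theta>}"] split: if_splits)

lemma represents_convex:
  assumes "represents p X" "represents q Y" "0 \<le> u" "u \<le> 1"
  shows "represents (\<lambda>\<theta>. (1 - u) * p \<theta> + u * q \<theta>) ((1 - u) *\<^sub>R X + u *\<^sub>R Y)"
proof -
  have p: "\<And>\<theta>. \<theta> \<in> eulerian_params \<Longrightarrow> 0 \<le> p \<theta>" "(p has_sum 1) eulerian_params"
    "\<And>n k. k < n \<Longrightarrow> ((\<lambda>\<theta>. p \<theta> * euler_kernel \<theta> n k) has_sum X n k) eulerian_params"
    and q: "\<And>\<theta>. \<theta> \<in> eulerian_params \<Longrightarrow> 0 \<le> q \<theta>" "(q has_sum 1) eulerian_params"
    "\<And>n k. k < n \<Longrightarrow> ((\<lambda>\<theta>. q \<theta> * euler_kernel \<theta> n k) has_sum Y n k) eulerian_params"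
    using assms by (auto simp: represents_def)
  show ?thesis
    unfolding represents_def
  proof (intro conjI ballI allI impI)
    show "0 \<le> (1 - u) * p \<theta> + u * q \<theta>" if "\<theta> \<in> eulerian_params" for \<theta>
      using p(1)[OF that] q(1)[OF that] assms by simp
    show "((\<lambda>\<theta>. (1 - u) * p \<theta> + u * q \<theta>) has_sum 1) eulerian_params"
      using has_sum_add[OF has_sum_cmult_right[OF p(2), of "1 - u"] has_sum_cmult_right[OF q(2), of u]] by simp
    show "((\<lambda>\<theta>. ((1 - u) * p \<theta> + u * q \<theta>) * euler_kernel \<theta> n k)
        has_sum ((1 - u) *\<^sub>R X + u *\<^sub>R Y) n k) eulerian_params" if "k < n" for n k
      using has_sum_add[OF has_sum_cmult_right[OF p(3), of _ _ "1 - u"] has_sum_cmult_right[OF q(3), of _ _ u], OF that that]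
      by (simp add: scaleR_fun_def algebra_simps)
  qed
qed

lemma array_eqI:
  assumes "X \<in> eulerian_arrays" "Y \<in> eulerian_arrays" "\<And>n k. k < n \<Longrightarrow> X n k = Y n k"
  shows "X = Y"
proof (intro ext)
  fix n k
  show "X n k = Y n k"
    using assms by (cases "k < n") (simp_all add: in_eulerian_arrays_iff)
qed

lemma represents_concentrated:
  assumes "X \<in> eulerian_arrays" "represents p X" "\<theta> \<in> eulerian_params"
    and zero: "\<And>x. x \<in> eulerian_params \<Longrightarrow> x \<noteq> \<theta> \<Longrightarrow> p x = 0"
  shows "X = euler_kernel \<theta>"
proof (rule array_eqI[OF assms(1) kernel_in_eulerian_arrays[OF assms(3)]])
  have single: "((\<lambda>x. p x * f x) has_sum (p \<theta> * f \<theta>)) eulerian_params" for f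
    using assms(3) zero by (intro has_sum_finite_neutralI[where B = "{\<theta>}"]) auto
  have p1: "p \<theta> = 1"
    using has_sum_unique[OF single[of "\<lambda>_. 1"]] assms(2) by (simp add: represents_def)
  fix n k :: nat assume "k < n"
  then have "((\<lambda>x. p x * euler_kernel x n k) has_sum X n k) eulerian_params"
    using assms(2) by (simp add: represents_def)
  then show "X n k = euler_kernel \<theta> n k"
    using has_sum_unique[OF single[of "\<lambda>x. euler_kernel x n k"]] p1 by simp
qed

text \<open>
  If the array is a proper convex combination of \<open>X\<close> and \<open>Y\<close>, then combining representations of
  \<open>X\<close> and \<open>Y\<close> must give, by uniqueness, the unit mass at \<open>\<theta>\<close>; hence both of them
  are concentrated at \<open>\<theta>\<close>.
\<close>

lemma kernel_extreme:
  assumes \<theta>: "\<theta> \<in> eulerian_params"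
  shows "euler_kernel \<theta> extreme_point_of eulerian_arrays"
  unfolding extreme_point_of_def
proof (intro conjI ballI notI)
  show K: "euler_kernel \<theta> \<in> eulerian_arrays" by (rule kernel_in_eulerian_arrays[OF \<theta>])
  fix X Y assume X: "X \<in> eulerian_arrays" and Y: "Y \<in> eulerian_arrays"
    and seg: "euler_kernel \<theta> \<in> open_segment X Y"
  obtain u where u: "0 < u" "u < 1" and eq: "euler_kernel \<theta> = (1 - u) *\<^sub>R X + u *\<^sub>R Y" and ne: "X \<noteq> Y"
    using seg by (auto simp: in_segment)
  obtain p q where p: "represents p X" and q: "represents q Y"
    using representation_exists X Y by meson
  have "represents (\<lambda>\<theta>. (1 - u) * p \<theta> + u * q \<theta>) (euler_kernel \<theta>)"
    unfolding eq using represents_convex[OF p q] u by simp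
  note unique = representation_unique[OF K this represents_point[OF \<theta>]]
  have "p x = 0 \<and> q x = 0" if x: "x \<in> eulerian_params" "x \<noteq> \<theta>" for x
  proof -
    have "(1 - u) * p x + u * q x = 0" using unique[OF x(1)] x(2) by simp
    moreover have "0 \<le> p x" "0 \<le> q x" using p q x(1) by (auto simp: represents_def)
    ultimately show ?thesis
      using u by (simp add: add_nonneg_eq_0_iff)
  qed
  then have "X = euler_kernel \<theta>" "Y = euler_kernel \<theta>"
    using represents_concentrated[OF X p \<theta>] represents_concentrated[OF Y q \<theta>] by auto
  then show False using ne by simp
qed

text \<open>
  Some parameter \<open>\<theta>\<close> has positive weight in a representation of \<open>W\<close>, and then a positive
  multiple of \<open>euler_kernel \<theta>\<close> can be split off; extremality leaves no other array to mix with.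
\<close>

lemma extreme_is_kernel:
  assumes W: "W extreme_point_of eulerian_arrays"
  shows "\<exists>\<theta>\<in>eulerian_params. W = euler_kernel \<theta>"
proof -
  have W_in: "W \<in> eulerian_arrays" using W by (simp add: extreme_point_of_def)
  obtain p where p: "represents p W" using representation_exists[OF W_in] ..
  then have p_nonneg: "\<And>x. x \<in> eulerian_params \<Longrightarrow> 0 \<le> p x"
    and p_sum: "(p has_sum 1) eulerian_params"
    and rep: "\<And>n k. k < n \<Longrightarrow> ((\<lambda>\<theta>. p \<theta> * euler_kernel \<theta> n k) has_sum W n k) eulerian_params"
    by (auto simp: represents_def)
  obtain \<theta> where \<theta>: "\<theta> \<in> eulerian_params" "p \<theta> \<noteq> 0"
    using has_sum_unique[OF p_sum] has_sum_0[of eulerian_params p] by force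
  have K: "euler_kernel \<theta> \<in> eulerian_arrays" by (rule kernel_in_eulerian_arrays[OF \<theta>(1)])
  \<comment> \<open>Half of the weight keeps \<open>1 - c\<close> positive even if the whole weight sits at \<open>\<theta>\<close>.\<close>
  define c where "c = p \<theta> / 2"
  have "p \<theta> \<le> 1"
    using finite_sum_le_has_sum[OF p_sum, of "{\<theta>}"] \<theta>(1) p_nonneg by simp
  then have c: "0 < c" "c < 1"
    using p_nonneg[OF \<theta>(1)] \<theta>(2) by (simp_all add: c_def)
  define Y where "Y n k = 1 / (1 - c) * (W n k - c * euler_kernel \<theta> n k)" for n k
  have cY: "(1 - c) * Y n k = W n k - c * euler_kernel \<theta> n k" for n k
    using c by (simp add: Y_def)
  have le: "c * euler_kernel \<theta> n k \<le> W n k" if "k < n" for n k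
  proof -
    have "p \<theta> * euler_kernel \<theta> n k \<le> W n k"
      using finite_sum_le_has_sum[OF rep[OF that], of "{\<theta>}"] \<theta>(1) p_nonneg
      by (auto intro!: mult_nonneg_nonneg kernel_nonneg)
    moreover have "c * euler_kernel \<theta> n k \<le> p \<theta> * euler_kernel \<theta> n k"
      using c(1) by (intro mult_right_mono kernel_nonneg \<theta>) (simp add: c_def)
    ultimately show ?thesis by linarith
  qed
  have "coherent Y"
    unfolding Y_def using W_in
    by (intro coherent_cmult coherent_diff coherent_kernel) (simp add: in_eulerian_arrays_iff)
  then have Y: "Y \<in> eulerian_arrays"
    using W_in K le c by (auto simp: in_eulerian_arrays_iff Y_def simp del: One_nat_def)
  have eq: "W = (1 - c) *\<^sub>R Y + c *\<^sub>R euler_kernel \<theta>"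
    by (intro ext) (simp add: scaleR_fun_def cY)
  have "Y = euler_kernel \<theta>"
  proof (rule ccontr)
    assume "Y \<noteq> euler_kernel \<theta>"
    then have "W \<in> open_segment Y (euler_kernel \<theta>)"
      using c eq by (auto simp: in_segment)
    then show False using W Y K by (simp add: extreme_point_of_def)
  qed
  then have "W = euler_kernel \<theta>"
    unfolding eq by (simp add: scaleR_left_distrib[symmetric])
  then show ?thesis using \<theta>(1) by blast
qed

lemma extreme_iff:
  assumes "\<theta> \<in> eulerian_params"
  shows "W extreme_point_of eulerian_arrays \<and> W 2 0 = \<theta> \<longleftrightarrow> W = euler_kernel \<theta>"
  using extreme_is_kernel[of W] kernel_extreme[OF assms] kernel_2_0 by metis

lemma eulerian_extreme_eq: "\<theta> \<in> eulerian_params \<Longrightarrow> eulerian_extreme \<theta> = euler_kernel \<theta>"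
  by (simp add: eulerian_extreme_def extreme_iff)

lemma represents_iff:
  assumes "p \<in> eulerian_params \<rightarrow>\<^sub>E {0..1}"
  shows "(p has_sum 1) eulerian_params \<and>
      (\<forall>n\<ge>1. \<forall>k<n. ((\<lambda>\<theta>. p \<theta> * eulerian_extreme \<theta> n k) has_sum V n k) eulerian_params)
    \<longleftrightarrow> represents p V"
proof -
  have nonneg: "\<forall>\<theta>\<in>eulerian_params. 0 \<le> p \<theta>" using assms by (auto simp: PiE_iff)
  have kernel: "((\<lambda>\<theta>. p \<theta> * eulerian_extreme \<theta> n k) has_sum V n k) eulerian_params
      \<longleftrightarrow> ((\<lambda>\<theta>. p \<theta> * euler_kernel \<theta> n k) has_sum V n k) eulerian_params" for n k
    by (intro has_sum_cong) (simp add: eulerian_extreme_eq)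
  have index: "(\<forall>n\<ge>1. \<forall>k<n. P n k) \<longleftrightarrow> (\<forall>n k. k < n \<longrightarrow> P n k)" for P :: "nat \<Rightarrow> nat \<Rightarrow> bool"
    using Suc_le_eq by fastforce
  show ?thesis unfolding represents_def kernel index using nonneg by blast
qed

theorem corollary3:
  shows "(\<forall>\<theta>\<in>eulerian_params. \<exists>!W. W extreme_point_of eulerian_arrays \<and> W 2 0 = \<theta>) \<and>
    (\<forall>V\<in>eulerian_arrays.
      \<exists>!p :: real \<Rightarrow> real.
        p \<in> eulerian_params \<rightarrow>\<^sub>E {0..1} \<and>
        (p has_sum 1) eulerian_params \<and>
        (\<forall>n\<ge>1. \<forall>k<n. ((\<lambda>\<theta>. p \<theta> * eulerian_extreme \<theta> n k) has_sum V n k) eulerian_params))"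
proof (intro conjI ballI)
  fix \<theta> assume "\<theta> \<in> eulerian_params"
  then show "\<exists>!W. W extreme_point_of eulerian_arrays \<and> W 2 0 = \<theta>"
    by (simp add: extreme_iff)
next
  fix V assume V: "V \<in> eulerian_arrays"
  obtain p where p: "represents p V" using representation_exists[OF V] ..
  define p' where "p' = FuncSet.restrict p eulerian_params"
  have p_sum: "(p has_sum 1) eulerian_params" using p by (simp add: represents_def)
  have "p \<theta> \<le> 1" if "\<theta> \<in> eulerian_params" for \<theta>
    using finite_sum_le_has_sum[OF p_sum, of "{\<theta>}"] p that by (simp add: represents_def)
  then have p'_PiE: "p' \<in> eulerian_params \<rightarrow>\<^sub>E {0..1}"
    using p by (auto simp: p'_def represents_def)
  have p': "represents p' V"
    using p unfolding represents_def p'_def by (simp cong: has_sum_cong)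
  show "\<exists>!p :: real \<Rightarrow> real.
        p \<in> eulerian_params \<rightarrow>\<^sub>E {0..1} \<and>
        (p has_sum 1) eulerian_params \<and>
        (\<forall>n\<ge>1. \<forall>k<n. ((\<lambda>\<theta>. p \<theta> * eulerian_extreme \<theta> n k) has_sum V n k) eulerian_params)"
  proof (rule ex1I[of _ p'])
    show "p' \<in> eulerian_params \<rightarrow>\<^sub>E {0..1} \<and>
        (p' has_sum 1) eulerian_params \<and>
        (\<forall>n\<ge>1. \<forall>k<n. ((\<lambda>\<theta>. p' \<theta> * eulerian_extreme \<theta> n k) has_sum V n k) eulerian_params)"
      using p' p'_PiE represents_iff[OF p'_PiE] by blast
    fix q :: "real \<Rightarrow> real"
    assume q: "q \<in> eulerian_params \<rightarrow>\<^sub>E {0..1} \<and>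
        (q has_sum 1) eulerian_params \<and>
        (\<forall>n\<ge>1. \<forall>k<n. ((\<lambda>\<theta>. q \<theta> * eulerian_extreme \<theta> n k) has_sum V n k) eulerian_params)"
    then have "represents q V" using represents_iff by blast
    then show "q = p'"
      using q p'_PiE representation_unique[OF V _ p'] by (intro PiE_ext) auto
  qed
qed

end
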